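(* Let $n\ge1$ and let $\theta_2,\theta_3,\kappa_0,\kappa_1,\ldots,\kappa_n,\rho_1,\ldots,\rho_n$ be complex numbers. Define \[ b_i=-\kappa_i-\rho_1\ (i=1,\ldots,n),\quad b'=-\theta_2,\quad c_1=-\kappa_0-\rho_1+1,\quad c_i=-\rho_1+\rho_i+1\ (i=2,\ldots,n),\quad c'=1-\theta_2-\theta_3 . \] Let $\delta_1=t_1\,\partial/\partial t_1$ and $\delta_2=(t_2-1)\,\partial/\partial t_2$, and let $z=z(t_1,t_2)$ be a (locally holomorphic) solution of \begin{align*} &\Big[t_1(\delta_1+\delta_2+c_1+c'-2)\Big\{\prod_{i=1}^n(\delta_1+b_i)\Big\}-\delta_1\Big\{\prod_{i=1}^n(\delta_1+c_i-1)\Big\}\Big]z=0,\\ &\{(1-t_2)(\delta_1+\delta_2+c_1+c'-2)(\delta_2+b')-\delta_2(\delta_2+c'-1)\}z=0. \end{align*} Set \begin{align*} w_0&=-\Big\{\prod_{j=1}^n(\delta_1+b_j)\Big\}(\delta_2+c'-1)z,\\ w_1&=-b_1(b'-c'+1)\Big\{\prod_{j=2}^n(\delta_1+b_j)\Big\}(\delta_1+c_1-1)z,\\ w_i&=-(b_i-c_i+1)(b'-c'+1)\Big\{\prod_{j=i+1}^n(\delta_1+b_j)\Big\}\Big\{\prod_{j=1}^{i-1}(\delta_1+c_j-1)\Big\}\delta_1z\quad(i=2,\ldots,n),\\ w'_1&=b_1\Big\{\prod_{j=2}^n(\delta_1+b_j)\Big\}(\delta_1+c_1-1)(\delta_2+b')z,\\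 w'_i&=(b_i-c_i+1)\Big\{\prod_{j=i+1}^n(\delta_1+b_j)\Big\}\Big\{\prod_{j=1}^{i-1}(\delta_1+c_j-1)\Big\}\delta_1(\delta_2+b')z\quad(i=2,\ldots,n). \end{align*} Then $\mathbf{w}={}^t[w_0,w_1,\ldots,w_n,w'_1,\ldots,w'_n]$ satisfies the linear Pfaff system \[ d\mathbf{w}=\{A_1^{(1)}d\log(t_1-1)+A_0^{(1)}d\log t_1+A_td\log(t_1-t_2)+A_1^{(2)}d\log(t_2-1)+A_0^{(2)}d\log t_2\}\mathbf{w}, \] where, indexing rows and columns by $0,1,\ldots,2n$ (index $i\in\{1,\dots,n\}$ corresponding to $w_i$ and index $n+i$ to $w'_i$) and letting $E_{i,j}$ denote the $(2n+1)\times(2n+1)$ matrix with $1$ in entry $(i,j)$ and $0$ elsewhere, \begin{align*} A_1^{(1)}&=\theta_3E_{0,0}+\sum_{j=1}^nE_{0,j}+\sum_{i=1}^n\Big\{\theta_3(\kappa_i+\rho_i)E_{i,0}+\sum_{j=1}^n(\kappa_i+\rho_i)E_{i,j}\Big\},\\ A_0^{(1)}&=(\kappa_0+\rho_1)E_{0,0}-\sum_{j=1}^nE_{0,j}-\sum_{j=1}^nE_{0,n+j}+\sum_{i=1}^n\Big\{(\rho_1-\rho_i)E_{i,i}-\sum_{j=i+1}^n(\kappa_i+\rho_i)E_{i,j}\Big\}\\ &\quad+\sum_{i=1}^n\Big\{(\rho_1-\rho_i)E_{n+i,n+i}-\sum_{j=i+1}^n(\kappa_i+\rho_i)E_{n+i,n+j}\Big\},\\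 A_t&=\theta_2E_{0,0}+\sum_{j=1}^nE_{0,n+j}+\sum_{i=1}^n\Big\{\theta_2(\kappa_i+\rho_i)E_{n+i,0}+\sum_{j=1}^n(\kappa_i+\rho_i)E_{n+i,n+j}\Big\},\\ A_1^{(2)}&=\sum_{i=1}^n\{\theta_2E_{i,i}-\theta_3E_{i,n+i}\}+\sum_{i=1}^n\{-\theta_2E_{n+i,i}+\theta_3E_{n+i,n+i}\},\\ A_0^{(2)}&=\sum_{i=1}^n\Big\{-\theta_2(\kappa_i+\rho_i)E_{n+i,0}+\theta_2E_{n+i,i}-\sum_{j=1}^{i-1}(\kappa_i+\rho_i)E_{n+i,n+j}+(\theta_2+\kappa_0-\kappa_i)E_{n+i,n+i}\Big\}. \end{align*}
   Context: $d$ denotes the exterior derivative with respect to $(t_1,t_2)$. Products of the commuting operators $\delta_1,\delta_2$ are compositions of differential operators; empty products equal $1$. *)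

theory Defs
  imports "HOL-Analysis.Analysis" "HOL-Library.Function_Algebras"
begin

type_synonym fn2 = "complex \<times> complex \<Rightarrow> complex"
type_synonym op2 = "fn2 \<Rightarrow> fn2"

definition holomorphic2_on :: "fn2 \<Rightarrow> (complex \<times> complex) set \<Rightarrow> bool" where
  "holomorphic2_on f U \<longleftrightarrow> open U \<and>
     (\<forall>p\<in>U. \<exists>c1 c2. (f has_derivative (\<lambda>h. c1 * fst h + c2 * snd h)) (at p))"

definition D1 :: op2 where "D1 f = (\<lambda>p. deriv (\<lambda>s. f (s, snd p)) (fst p))"
definition D2 :: op2 where "D2 f = (\<lambda>p. deriv (\<lambda>s. f (fst p, s)) (snd p))"
definition delta1 :: op2 where "delta1 f = (\<lambda>p. fst p * D1 f p)"
definition delta2 :: op2 where "delta2 f = (\<lambda>p. (snd p - 1) * D2 f p)"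

definition shiftop :: "op2 \<Rightarrow> complex \<Rightarrow> op2" where
  "shiftop D c f = (\<lambda>p. D f p + c * f p)"

definition opprod :: "op2 list \<Rightarrow> op2" where
  "opprod L = foldr (\<circ>) L id"

definition scal :: "complex \<Rightarrow> fn2 \<Rightarrow> fn2" where
  "scal c f = (\<lambda>p. c * f p)"

definition bpar :: "(nat \<Rightarrow> complex) \<Rightarrow> (nat \<Rightarrow> complex) \<Rightarrow> nat \<Rightarrow> complex" where
  "bpar kappa rho i = - kappa i - rho 1"
definition cpar :: "(nat \<Rightarrow> complex) \<Rightarrow> (nat \<Rightarrow> complex) \<Rightarrow> nat \<Rightarrow> complex" where
  "cpar kappa rho i = (if i = 1 then - kappa 0 - rho 1 + 1 else - rho 1 + rho i + 1)"
definition bprime :: "complex \<Rightarrow> complex" where "bprime th2 = - th2"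
definition cprime :: "complex \<Rightarrow> complex \<Rightarrow> complex" where "cprime th2 th3 = 1 - th2 - th3"

definition eq1 :: "nat \<Rightarrow> complex \<Rightarrow> complex \<Rightarrow> (nat \<Rightarrow> complex) \<Rightarrow> (nat \<Rightarrow> complex) \<Rightarrow> fn2 \<Rightarrow> fn2" where
  "eq1 n th2 th3 kappa rho z = (\<lambda>p.
     fst p * (let g = opprod (map (\<lambda>i. shiftop delta1 (bpar kappa rho i)) [1..<n+1]) z in
       delta1 g p + delta2 g p + (cpar kappa rho 1 + cprime th2 th3 - 2) * g p)
     - delta1 (opprod (map (\<lambda>i. shiftop delta1 (cpar kappa rho i - 1)) [1..<n+1]) z) p)"

definition eq2 :: "complex \<Rightarrow> complex \<Rightarrow> (nat \<Rightarrow> complex) \<Rightarrow> (nat \<Rightarrow> complex) \<Rightarrow> fn2 \<Rightarrow> fn2" where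
  "eq2 th2 th3 kappa rho z = (\<lambda>p.
     (1 - snd p) * (let g = shiftop delta2 (bprime th2) z in
       delta1 g p + delta2 g p + (cpar kappa rho 1 + cprime th2 th3 - 2) * g p)
     - delta2 (shiftop delta2 (cprime th2 th3 - 1) z) p)"

text \<open>The vector w, indexed by 0..2n (index i for w_i, n+i for w'_i).\<close>
definition wvec :: "nat \<Rightarrow> complex \<Rightarrow> complex \<Rightarrow> (nat \<Rightarrow> complex) \<Rightarrow> (nat \<Rightarrow> complex) \<Rightarrow> fn2 \<Rightarrow> nat \<Rightarrow> fn2" where
  "wvec n th2 th3 kappa rho z k =
    (let b = bpar kappa rho; c = cpar kappa rho; b' = bprime th2; c' = cprime th2 th3;
         PB = (\<lambda>lo. opprod (map (\<lambda>j. shiftop delta1 (b j)) [lo..<n+1]));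
         PC = (\<lambda>hi. opprod (map (\<lambda>j. shiftop delta1 (c j - 1)) [1..<hi+1]))
     in if k = 0 then scal (-1) (PB 1 (shiftop delta2 (c' - 1) z))
        else if k = 1 then scal (- b 1 * (b' - c' + 1)) (PB 2 (shiftop delta1 (c 1 - 1) z))
        else if k \<le> n then scal (- (b k - c k + 1) * (b' - c' + 1)) (PB (k+1) (PC (k-1) (delta1 z)))
        else if k = n + 1 then scal (b 1) (PB 2 (shiftop delta1 (c 1 - 1) (shiftop delta2 b' z)))
        else scal (b (k-n) - c (k-n) + 1) (PB (k-n+1) (PC (k-n-1) (delta1 (shiftop delta2 b' z)))))"

definition Em :: "nat \<Rightarrow> nat \<Rightarrow> nat \<Rightarrow> nat \<Rightarrow> complex" where
  "Em i j = (\<lambda>r s. if r = i \<and> s = j then 1 else 0)"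
definition sm :: "complex \<Rightarrow> (nat \<Rightarrow> nat \<Rightarrow> complex) \<Rightarrow> nat \<Rightarrow> nat \<Rightarrow> complex" where
  "sm c M = (\<lambda>r s. c * M r s)"

definition A11 :: "nat \<Rightarrow> complex \<Rightarrow> complex \<Rightarrow> (nat \<Rightarrow> complex) \<Rightarrow> (nat \<Rightarrow> complex) \<Rightarrow> nat \<Rightarrow> nat \<Rightarrow> complex" where
  "A11 n th2 th3 kappa rho =
     sm th3 (Em 0 0) + (\<Sum>j=1..n. Em 0 j)
     + (\<Sum>i=1..n. sm (th3 * (kappa i + rho i)) (Em i 0) + (\<Sum>j=1..n. sm (kappa i + rho i) (Em i j)))"

definition A01 :: "nat \<Rightarrow> complex \<Rightarrow> complex \<Rightarrow> (nat \<Rightarrow> complex) \<Rightarrow> (nat \<Rightarrow> complex) \<Rightarrow> nat \<Rightarrow> nat \<Rightarrow> complex" where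
  "A01 n th2 th3 kappa rho =
     sm (kappa 0 + rho 1) (Em 0 0) - (\<Sum>j=1..n. Em 0 j) - (\<Sum>j=1..n. Em 0 (n+j))
     + (\<Sum>i=1..n. sm (rho 1 - rho i) (Em i i) - (\<Sum>j=i+1..n. sm (kappa i + rho i) (Em i j)))
     + (\<Sum>i=1..n. sm (rho 1 - rho i) (Em (n+i) (n+i))
                 - (\<Sum>j=i+1..n. sm (kappa i + rho i) (Em (n+i) (n+j))))"

definition At :: "nat \<Rightarrow> complex \<Rightarrow> complex \<Rightarrow> (nat \<Rightarrow> complex) \<Rightarrow> (nat \<Rightarrow> complex) \<Rightarrow> nat \<Rightarrow> nat \<Rightarrow> complex" where
  "At n th2 th3 kappa rho =
     sm th2 (Em 0 0) + (\<Sum>j=1..n. Em 0 (n+j))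
     + (\<Sum>i=1..n. sm (th2 * (kappa i + rho i)) (Em (n+i) 0)
                 + (\<Sum>j=1..n. sm (kappa i + rho i) (Em (n+i) (n+j))))"

definition A12 :: "nat \<Rightarrow> complex \<Rightarrow> complex \<Rightarrow> (nat \<Rightarrow> complex) \<Rightarrow> (nat \<Rightarrow> complex) \<Rightarrow> nat \<Rightarrow> nat \<Rightarrow> complex" where
  "A12 n th2 th3 kappa rho =
     (\<Sum>i=1..n. sm th2 (Em i i) - sm th3 (Em i (n+i)))
     + (\<Sum>i=1..n. - sm th2 (Em (n+i) i) + sm th3 (Em (n+i) (n+i)))"

definition A02 :: "nat \<Rightarrow> complex \<Rightarrow> complex \<Rightarrow> (nat \<Rightarrow> complex) \<Rightarrow> (nat \<Rightarrow> complex) \<Rightarrow> nat \<Rightarrow> nat \<Rightarrow> complex" where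
  "A02 n th2 th3 kappa rho =
     (\<Sum>i=1..n. - sm (th2 * (kappa i + rho i)) (Em (n+i) 0) + sm th2 (Em (n+i) i)
                 - (\<Sum>j=1..i-1. sm (kappa i + rho i) (Em (n+i) (n+j)))
                 + sm (th2 + kappa 0 - kappa i) (Em (n+i) (n+i)))"

end

(* The equations and the components of w only involve the commuting operators delta1, delta2, so
   everything can be computed with polynomials in X = delta1, Y = delta2 applied to z; the analytic
   input is that partial derivatives of z are again holomorphic and commute.

   Write B = prod (X + b_j), D = B (X + c_1 - 1), E = X + Y + c_1 + c' - 2, y = (Y + b') z and
   e_i = kappa_i + rho_i, and let Q_i be the operator with w_i = theta_3 e_i Q_i z and
   w'_i = - e_i Q_i y.  Consecutive Q_i satisfy
   (X + rho_i - rho_1) Q_i = (X + b_{i+1}) Q_{i+1}, which telescopes to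
   X Q_i = T + (rho_1 - rho_i) Q_i - sum_{j>i} e_j Q_j  and  T = D + sum_j e_j Q_j,
   where T = X prod (X + c_j - 1) is the operator in the first equation t_1 E B z = T z.
   Since E B = D + B (Y + c' - 1), this gives (t_1 - 1) E B z = w_0 + sum_j e_j Q_j z.
   As y solves the first equation as well, the second equation gives
   (t_1 - t_2) E B y = sum_j e_j Q_j y - theta_2 w_0.
   These two formulas are the source of the poles at t_1 = 1 and t_1 = t_2. *)
theory Submission
  imports Defs "HOL-Complex_Analysis.Cauchy_Integral_Formula" "HOL-Computational_Algebra.Polynomial"
begin

section \<open>Holomorphic functions of two variables\<close>

text \<open>Continuity together with holomorphy in each variable is what the one-variable Cauchy
  formula can use directly, and the property passes to partial derivatives. Total differentiability
  is recovered in \<open>sep_holo_has_derivative\<close>.\<close>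

definition sep_holo :: "fn2 \<Rightarrow> (complex \<times> complex) set \<Rightarrow> bool" where
  "sep_holo f U \<longleftrightarrow> open U \<and> continuous_on U f \<and>
     (\<forall>x y. (x, y) \<in> U \<longrightarrow> (\<lambda>s. f (s, y)) field_differentiable at x \<and>
                         (\<lambda>s. f (x, s)) field_differentiable at y)"

lemma sep_holo_D1: "sep_holo f U \<Longrightarrow> (x, y) \<in> U \<Longrightarrow>
    ((\<lambda>s. f (s, y)) has_field_derivative D1 f (x, y)) (at x)"
  by (auto simp: sep_holo_def D1_def field_differentiable_derivI)

lemma sep_holo_D2: "sep_holo f U \<Longrightarrow> (x, y) \<in> U \<Longrightarrow>
    ((\<lambda>s. f (x, s)) has_field_derivative D2 f (x, y)) (at y)"
  by (auto simp: sep_holo_def D2_def field_differentiable_derivI)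

text \<open>Exchanging the variables carries every result on \<open>D1\<close> over to
  \<open>D2\<close>, by way of \<open>D2_swap\<close>.\<close>

lemma sep_holo_swap:
  assumes "sep_holo f U" shows "sep_holo (f \<circ> prod.swap) (prod.swap ` U)"
proof -
  have eq: "prod.swap ` U = prod.swap -` U"
    by (auto simp: image_iff) (metis swap_simp)
  have c: "continuous_on UNIV (prod.swap :: complex \<times> complex \<Rightarrow> _)"
    by (rule continuous_on_swap)
  have 1: "open (prod.swap -` U)"
    using assms c by (auto simp: sep_holo_def intro: open_vimage)
  have 2: "continuous_on (prod.swap -` U) (f \<circ> prod.swap)"
    unfolding o_def using assms
    by (intro continuous_on_compose2[of U f _ prod.swap] continuous_on_swap) (auto simp: sep_holo_def)
  show ?thesis
    unfolding eq using assms 1 2 by (auto simp: sep_holo_def o_def)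
qed

lemma D2_swap: "D2 f = D1 (f \<circ> prod.swap) \<circ> prod.swap"
  by (auto simp: D1_def D2_def fun_eq_iff)

lemma swap_image_swap: "prod.swap ` prod.swap ` U = U"
  by (auto simp: image_comp)

section \<open>Cauchy's formula in the first variable, with the second as a parameter\<close>

lemma open_contains_bidisc:
  fixes U :: "(complex \<times> complex) set"
  assumes "open U" "(a, b) \<in> U"
  obtains r where "0 < r" "cball a r \<times> cball b r \<subseteq> U"
proof -
  obtain A B where AB: "open A" "open B" "a \<in> A" "b \<in> B" "A \<times> B \<subseteq> U"
    using open_prod_elim[OF assms] by (metis SigmaE2)
  obtain r s where "0 < r" "cball a r \<subseteq> A" "0 < s" "cball b s \<subseteq> B"
    using AB by (meson open_contains_cball)
  then show ?thesis using AB(5) by (intro that[of "min r s"]) (auto simp: subset_iff)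
qed

text \<open>The weight in Cauchy's formula for the first derivative: the velocity of the circle
  contributes 2 pi i r exp(2 pi i t), and its factor 2 pi i cancels the normalisation.\<close>

definition cauchy_kernel :: "complex \<Rightarrow> real \<Rightarrow> complex \<Rightarrow> real \<Rightarrow> complex" where
  "cauchy_kernel a r x t = r * exp (2 * of_real pi * \<i> * t) / (circlepath a r t - x)^2"

lemma circlepath_in_cball: "0 < r \<Longrightarrow> circlepath a r t \<in> cball a r"
  by (auto simp: circlepath dist_norm norm_mult)

lemma circlepath_ne: "x \<in> ball a r \<Longrightarrow> circlepath a r t \<noteq> x"
  by (auto simp: circlepath dist_norm norm_mult)

lemma continuous_on_circlepath: "continuous_on S (circlepath a r)"
  unfolding circlepath by (intro continuous_intros)

text \<open>The point enters only as a parameter of an integral over a fixed compact interval, so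
  continuity and differentiability of \<open>D1 f\<close> follow from theorems on parameter
  integrals.\<close>

lemma D1_cauchy:
  assumes f: "sep_holo f U" and r: "0 < r" "cball a r \<times> cball b r \<subseteq> U"
    and x: "x \<in> ball a r" and y: "y \<in> ball b r"
  shows "D1 f (x, y) = integral (cbox 0 1) (\<lambda>t. f (circlepath a r t, y) * cauchy_kernel a r x t)"
proof -
  have U: "(s, y) \<in> U" if "s \<in> cball a r" for s
    using that r y by auto
  have hol: "(\<lambda>s. f (s, y)) field_differentiable at s" if "s \<in> cball a r" for s
    using f U[OF that] by (auto simp: sep_holo_def)
  have 1: "(\<lambda>s. f (s, y)) holomorphic_on ball a r"
    by (auto simp: holomorphic_on_def intro!: field_differentiable_at_within hol)
  have 2: "continuous_on (cball a r) (\<lambda>s. f (s, y))"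
    by (intro continuous_at_imp_continuous_on ballI field_differentiable_imp_continuous_at hol)
  have "((\<lambda>s. f (s, y)) has_field_derivative (1 / (2 * of_real pi * \<i>) *
      contour_integral (circlepath a r) (\<lambda>u. f (u, y) / (u-x)^2))) (at x)"
    by (rule Cauchy_derivative_integral_circlepath(2)[OF 2 1 x])
  then have "D1 f (x, y) = 1 / (2 * of_real pi * \<i>) *
      contour_integral (circlepath a r) (\<lambda>u. f (u, y) / (u-x)^2)"
    by (simp add: D1_def DERIV_imp_deriv)
  also have "\<dots> = integral {0..1} (\<lambda>t. 1 / (2 * of_real pi * \<i>) *
      (f (circlepath a r t, y) / (circlepath a r t - x)^2 * vector_derivative (circlepath a r) (at t)))"
    by (subst integral_mult_right) (simp add: contour_integral_integral)
  also have "\<dots> = integral (cbox 0 1) (\<lambda>t. f (circlepath a r t, y) * cauchy_kernel a r x t)"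
    by (intro arg_cong2[where f=integral] ext) (simp_all add: cauchy_kernel_def vector_derivative_circlepath mult.left_commute[of _ \<i>])
  finally show ?thesis .
qed

lemma continuous_on_cauchy_integrand:
  assumes f: "continuous_on U f" and r: "0 < r" "cball a r \<times> cball b r \<subseteq> U"
  shows "continuous_on ((ball a r \<times> ball b r) \<times> T)
           (\<lambda>(p, t). f (circlepath a r t, snd p) * cauchy_kernel a r (fst p) t)"
proof -
  have U: "(circlepath a r t, y) \<in> U" if "y \<in> ball b r" for t y
    using that r circlepath_in_cball[OF r(1), of a t] by auto
  have "continuous_on ((ball a r \<times> ball b r) \<times> T) (\<lambda>q. f (circlepath a r (snd q), snd (fst q)))"
    by (intro continuous_on_compose2[OF f] continuous_intros
          continuous_on_compose2[OF continuous_on_circlepath[of UNIV]]) (auto simp: U)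
  moreover have "continuous_on ((ball a r \<times> ball b r) \<times> T) (\<lambda>q. cauchy_kernel a r (fst (fst q)) (snd q))"
    unfolding cauchy_kernel_def
    by (intro continuous_intros continuous_on_compose2[OF continuous_on_circlepath[of UNIV]])
       (auto dest: circlepath_ne)
  ultimately show ?thesis
    by (auto simp: case_prod_unfold intro: continuous_on_mult)
qed

lemma continuous_on_D1:
  assumes f: "sep_holo f U" shows "continuous_on U (D1 f)"
proof (rule continuous_at_imp_continuous_on, clarify)
  fix a b assume ab: "(a, b) \<in> U"
  have op: "open U" and cf: "continuous_on U f" using f by (auto simp: sep_holo_def)
  obtain r where r: "0 < r" "cball a r \<times> cball b r \<subseteq> U"
    using open_contains_bidisc[OF op ab] .
  have "continuous_on (ball a r \<times> ball b r)
      (\<lambda>p. integral (cbox 0 1) (\<lambda>t. f (circlepath a r t, snd p) * cauchy_kernel a r (fst p) t))"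
    by (rule integral_continuous_on_param[OF continuous_on_cauchy_integrand[OF cf r]])
  then have "continuous_on (ball a r \<times> ball b r) (D1 f)"
    by (rule continuous_on_eq) (auto simp: D1_cauchy[OF f r])
  then show "isCont (D1 f) (a, b)"
    using r by (auto simp: continuous_on_eq_continuous_at open_Times)
qed

lemma continuous_on_D2:
  assumes f: "sep_holo f U" shows "continuous_on U (D2 f)"
  unfolding D2_swap
  using continuous_on_D1[OF sep_holo_swap[OF f]]
  by (intro continuous_on_compose continuous_on_swap)

text \<open>Differentiation under the integral sign, justified by continuity of \<open>D2 f\<close>.
  The result is also the Cauchy integral of \<open>D2 f\<close>, so it yields differentiability of
  \<open>D1 f\<close> in y and the symmetry of mixed derivatives at once.\<close>

lemma D2_D1_cauchy:
  assumes f: "sep_holo f U" and ab: "(a, b) \<in> U"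
    and r: "0 < r" "cball a r \<times> cball b r \<subseteq> U"
  shows "((\<lambda>y. D1 f (a, y)) has_field_derivative
    integral (cbox 0 1) (\<lambda>t. D2 f (circlepath a r t, b) * cauchy_kernel a r a t)) (at b)"
proof -
  have cf: "continuous_on U f" using f by (auto simp: sep_holo_def)
  have a: "a \<in> ball a r" using r by simp
  have "((\<lambda>y. integral (cbox 0 1) (\<lambda>t. f (circlepath a r t, y) * cauchy_kernel a r a t)) has_field_derivative
      integral (cbox 0 1) (\<lambda>t. D2 f (circlepath a r t, b) * cauchy_kernel a r a t)) (at b within ball b r)"
  proof (rule leibniz_rule_field_derivative)
    fix y and t :: real assume y: "y \<in> ball b r"
    then have "(circlepath a r t, y) \<in> U" using r circlepath_in_cball[OF r(1), of a t] by auto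
    then show "((\<lambda>y. f (circlepath a r t, y) * cauchy_kernel a r a t) has_field_derivative
        D2 f (circlepath a r t, y) * cauchy_kernel a r a t) (at y within ball b r)"
      by (intro has_field_derivative_at_within[OF DERIV_cmult_right[OF sep_holo_D2[OF f]]])
  next
    fix y assume y: "y \<in> ball b r"
    have "continuous_on (cbox 0 1) (\<lambda>t. f (circlepath a r t, y) * cauchy_kernel a r a t)"
      using continuous_on_compose2[OF continuous_on_cauchy_integrand[OF cf r, of UNIV],
          of "cbox 0 1" "\<lambda>t. ((a, y), t)"] a y
      by (simp add: continuous_on_Pair continuous_on_const continuous_on_id image_subset_iff)
    then show "(\<lambda>t. f (circlepath a r t, y) * cauchy_kernel a r a t) integrable_on cbox 0 1"
      by (rule integrable_continuous)
  next
    show "continuous_on (ball b r \<times> cbox 0 1) (\<lambda>(y, t). D2 f (circlepath a r t, y) * cauchy_kernel a r a t)"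
      using continuous_on_compose2[OF continuous_on_cauchy_integrand[OF continuous_on_D2[OF f] r, of UNIV],
          of "ball b r \<times> cbox 0 1" "\<lambda>q. ((a, fst q), snd q)"] a
      by (simp add: case_prod_unfold continuous_on_Pair continuous_on_const continuous_on_fst
          continuous_on_snd continuous_on_id image_subset_iff)
  qed (use r in auto)
  then have "((\<lambda>y. integral (cbox 0 1) (\<lambda>t. f (circlepath a r t, y) * cauchy_kernel a r a t)) has_field_derivative
      integral (cbox 0 1) (\<lambda>t. D2 f (circlepath a r t, b) * cauchy_kernel a r a t)) (at b)"
    using r by (simp add: at_within_open[of b "ball b r"])
  \<comment> \<open>\<open>D1_cauchy\<close> identifies the integral with \<open>D1 f (a, y)\<close>
    only for y in the disc around b, hence the passage through eventual equality.\<close>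
  then show ?thesis
    by (rule DERIV_cong_ev[THEN iffD1, rotated -1])
       (use r in \<open>auto intro!: eventually_mono[OF eventually_nhds_in_open[of "ball b r" b]] simp: D1_cauchy[OF f r a]\<close>)
qed

lemma sep_holo_D1_sep:
  assumes f: "sep_holo f U" shows "sep_holo (D1 f) U"
  unfolding sep_holo_def
proof (intro conjI allI impI)
  have op: "open U" using f by (auto simp: sep_holo_def)
  then show "open U" "continuous_on U (D1 f)" using continuous_on_D1[OF f] by auto
  fix a b assume ab: "(a, b) \<in> U"
  obtain r where r: "0 < r" "cball a r \<times> cball b r \<subseteq> U"
    using open_contains_bidisc[OF op ab] .
  show "(\<lambda>y. D1 f (a, y)) field_differentiable at b"
    using D2_D1_cauchy[OF f ab r] by (auto simp: field_differentiable_def)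
  have "(s, b) \<in> U" if "s \<in> ball a r" for s
    using that r by auto
  then have "(\<lambda>s. f (s, b)) holomorphic_on ball a r"
    using f by (simp add: holomorphic_on_def sep_holo_def field_differentiable_at_within)
  then have "deriv (\<lambda>s. f (s, b)) holomorphic_on ball a r" by (rule holomorphic_deriv) simp
  then show "(\<lambda>x. D1 f (x, b)) field_differentiable at a"
    using r by (auto simp: D1_def holomorphic_on_open field_differentiable_def)
qed

lemma sep_holo_D2_sep:
  assumes f: "sep_holo f U" shows "sep_holo (D2 f) U"
  unfolding D2_swap
  using sep_holo_swap[OF sep_holo_D1_sep[OF sep_holo_swap[OF f]]] by (simp add: swap_image_swap)

text \<open>Both sides equal the same Cauchy integral of \<open>D2 f\<close>.\<close>

lemma D2_D1_commute:
  assumes f: "sep_holo f U" and ab: "(a, b) \<in> U"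
  shows "D2 (D1 f) (a, b) = D1 (D2 f) (a, b)"
proof -
  have op: "open U" using f by (auto simp: sep_holo_def)
  obtain r where r: "0 < r" "cball a r \<times> cball b r \<subseteq> U"
    using open_contains_bidisc[OF op ab] .
  show ?thesis
    using DERIV_imp_deriv[OF D2_D1_cauchy[OF f ab r]] D1_cauchy[OF sep_holo_D2_sep[OF f] r, of a b] r
    by (simp add: D2_def)
qed

text \<open>Partial derivatives that exist near the point and are continuous there give a total
  derivative; \<open>continuous_on_D2\<close> supplies the continuity.\<close>

lemma sep_holo_has_derivative:
  assumes f: "sep_holo f U" and ab: "(a, b) \<in> U"
  shows "(f has_derivative (\<lambda>h. D1 f (a, b) * fst h + D2 f (a, b) * snd h)) (at (a, b))"
proof -
  have op: "open U" using f by (auto simp: sep_holo_def)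
  obtain r where r: "0 < r" "cball a r \<times> cball b r \<subseteq> U"
    using open_contains_bidisc[OF op ab] .
  have [simp]: "a \<in> ball a r" "b \<in> ball b r" using r by auto
  have sub: "ball a r \<times> ball b r \<subseteq> U" using r by auto
  have "((\<lambda>(x, y). f (x, y)) has_derivative
      (\<lambda>(tx, ty). D1 f (a, b) * tx + blinfun_apply (blinfun_mult_right (D2 f (a, b))) ty))
      (at (a, b) within ball a r \<times> ball b r)"
  proof (rule has_derivative_partialsI[where fy="\<lambda>x y. blinfun_mult_right (D2 f (x, y))"])
    show "((\<lambda>x. f (x, b)) has_derivative (*) (D1 f (a, b))) (at a within ball a r)"
      using sep_holo_D1[OF f ab]
      by (simp add: has_field_derivative_def has_derivative_at_withinI)
    fix x y assume "x \<in> ball a r" "y \<in> ball b r"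
    then show "((\<lambda>y. f (x, y)) has_derivative blinfun_apply (blinfun_mult_right (D2 f (x, y)))) (at y within ball b r)"
      using sep_holo_D2[OF f, of x y] sub
      by (simp add: has_field_derivative_def has_derivative_at_withinI subset_iff)
  next
    have "continuous_on (ball a r \<times> ball b r) (D2 f)"
      using continuous_on_D2[OF f] sub continuous_on_subset by blast
    then have "(D2 f \<longlongrightarrow> D2 f (a, b)) (at (a, b) within ball a r \<times> ball b r)"
      using r by (auto simp: continuous_on_def)
    then show "continuous (at (a, b) within ball a r \<times> ball b r) (\<lambda>(x, y). blinfun_mult_right (D2 f (x, y)))"
      unfolding case_prod_unfold continuous_within
      by (simp add: bounded_linear.tendsto[OF bounded_linear_blinfun_mult_right])
  qed (use r in auto)
  then have "(f has_derivative (\<lambda>h. D1 f (a, b) * fst h + D2 f (a, b) * snd h)) (at (a, b) within ball a r \<times> ball b r)"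
    by (simp add: case_prod_unfold)
  then show ?thesis using r by (simp add: at_within_open[of "(a,b)" "ball a r \<times> ball b r"] open_Times)
qed

lemma sep_holo_if_holomorphic2:
  assumes "holomorphic2_on f U" shows "sep_holo f U"
  unfolding sep_holo_def
proof (intro conjI allI impI)
  have d: "\<exists>c1 c2. (f has_derivative (\<lambda>h. c1 * fst h + c2 * snd h)) (at p)" if "p \<in> U" for p
    using assms that by (auto simp: holomorphic2_on_def)
  show "open U" using assms by (auto simp: holomorphic2_on_def)
  show "continuous_on U f"
    by (meson d continuous_at_imp_continuous_on has_derivative_continuous)
  fix x y assume "(x, y) \<in> U"
  then obtain c1 c2 where c: "(f has_derivative (\<lambda>h. c1 * fst h + c2 * snd h)) (at (x, y))"
    using d by blast
  have "((\<lambda>s. f (s, y)) has_derivative (\<lambda>h. c1 * fst (h, 0::complex) + c2 * snd (h, 0::complex))) (at x)"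
    by (rule has_derivative_compose[of "\<lambda>s. (s, y)" "\<lambda>h. (h, 0)" x UNIV f, OF _ c])
       (auto intro!: derivative_eq_intros)
  then show "(\<lambda>s. f (s, y)) field_differentiable at x"
    by (auto simp: field_differentiable_def has_field_derivative_def)
  have "((\<lambda>s. f (x, s)) has_derivative (\<lambda>h. c1 * fst (0::complex, h) + c2 * snd (0::complex, h))) (at y)"
    by (rule has_derivative_compose[of "\<lambda>s. (x, s)" "\<lambda>h. (0, h)" y UNIV f, OF _ c])
       (auto intro!: derivative_eq_intros)
  then show "(\<lambda>s. f (x, s)) field_differentiable at y"
    by (auto simp: field_differentiable_def has_field_derivative_def)
qed

section \<open>Locality, closure properties and commutation of the two operators\<close>

lemma D1_cong:
  assumes "open U" "(x, y) \<in> U" "\<And>p. p \<in> U \<Longrightarrow> f p = g p"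
  shows "D1 f (x, y) = D1 g (x, y)"
proof -
  have "eventually (\<lambda>s. (s, y) \<in> U) (nhds x)"
    using eventually_nhds_in_open[of "(\<lambda>s. (s, y)) -` U" x] assms
    by (simp add: open_vimage continuous_on_Pair continuous_on_id continuous_on_const)
  then show ?thesis
    unfolding D1_def by (intro deriv_cong_ev) (auto elim!: eventually_mono simp: assms(3))
qed

lemma D2_cong:
  assumes "open U" "(x, y) \<in> U" "\<And>p. p \<in> U \<Longrightarrow> f p = g p"
  shows "D2 f (x, y) = D2 g (x, y)"
proof -
  have "eventually (\<lambda>s. (x, s) \<in> U) (nhds y)"
    using eventually_nhds_in_open[of "(\<lambda>s. (x, s)) -` U" y] assms
    by (simp add: open_vimage continuous_on_Pair continuous_on_id continuous_on_const)
  then show ?thesis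
    unfolding D2_def by (intro deriv_cong_ev) (auto elim!: eventually_mono simp: assms(3))
qed

text \<open>The differential equations and the identities derived from them hold only on
  \<open>U\<close>; since \<open>U\<close> is open they may still be differentiated.\<close>

lemma delta1_cong:
  "open U \<Longrightarrow> p \<in> U \<Longrightarrow> (\<And>p. p \<in> U \<Longrightarrow> f p = g p) \<Longrightarrow> delta1 f p = delta1 g p"
  using D1_cong[of U "fst p" "snd p" f g] by (simp add: delta1_def)

lemma delta2_cong:
  "open U \<Longrightarrow> p \<in> U \<Longrightarrow> (\<And>p. p \<in> U \<Longrightarrow> f p = g p) \<Longrightarrow> delta2 f p = delta2 g p"
  using D2_cong[of U "fst p" "snd p" f g] by (simp add: delta2_def)

lemma sep_holo_mult: "sep_holo f U \<Longrightarrow> sep_holo g U \<Longrightarrow> sep_holo (\<lambda>p. f p * g p) U"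
  by (auto simp: sep_holo_def intro!: continuous_on_mult field_differentiable_mult)

lemma sep_holo_const: "open U \<Longrightarrow> sep_holo (\<lambda>p. c) U"
  by (auto simp: sep_holo_def)

lemma sep_holo_fst: "open U \<Longrightarrow> sep_holo fst U"
  by (auto simp: sep_holo_def continuous_on_fst continuous_on_id)

lemma sep_holo_snd_shift: "open U \<Longrightarrow> sep_holo (\<lambda>p. snd p - c) U"
  by (auto simp: sep_holo_def continuous_on_snd continuous_on_id intro!: continuous_intros field_differentiable_diff)

lemma sep_holo_sum: "open U \<Longrightarrow> (\<And>i. i \<in> I \<Longrightarrow> sep_holo (f i) U) \<Longrightarrow> sep_holo (\<lambda>p. \<Sum>i\<in>I. f i p) U"
  by (auto simp: sep_holo_def intro!: continuous_on_sum field_differentiable_sum)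

lemma sep_holo_delta1: "sep_holo f U \<Longrightarrow> sep_holo (delta1 f) U"
  unfolding delta1_def[abs_def]
  by (rule sep_holo_mult[OF sep_holo_fst sep_holo_D1_sep]) (auto simp: sep_holo_def)

lemma sep_holo_delta2: "sep_holo f U \<Longrightarrow> sep_holo (delta2 f) U"
  unfolding delta2_def[abs_def]
  by (rule sep_holo_mult[OF sep_holo_snd_shift sep_holo_D2_sep]) (auto simp: sep_holo_def)

lemma delta2_delta1_commute:
  assumes f: "sep_holo f U" and "p \<in> U"
  shows "delta2 (delta1 f) p = delta1 (delta2 f) p"
proof -
  obtain x y where p: "p = (x, y)" by fastforce
  with assms have xy: "(x, y) \<in> U" by simp
  have "((\<lambda>s. x * D1 f (x, s)) has_field_derivative x * D2 (D1 f) (x, y)) (at y)"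
    by (intro DERIV_cmult sep_holo_D2[OF sep_holo_D1_sep[OF f] xy])
  moreover have "((\<lambda>s. (y - 1) * D2 f (s, y)) has_field_derivative (y - 1) * D1 (D2 f) (x, y)) (at x)"
    by (intro DERIV_cmult sep_holo_D1[OF sep_holo_D2_sep[OF f] xy])
  ultimately show ?thesis
    using D2_D1_commute[OF f xy]
    by (simp add: p delta1_def delta2_def D1_def[of "\<lambda>p. (snd p - 1) * D2 f p"]
        D2_def[of "\<lambda>p. fst p * D1 f p"] DERIV_imp_deriv)
qed

section \<open>Polynomials in the two operators\<close>

text \<open>General enough to be nested: in \<open>act\<close> the outer sum has polynomials as
  coefficients, and each of its terms is again such a sum.\<close>

definition poly_sum :: "(nat \<Rightarrow> 'a::zero \<Rightarrow> 'b::comm_monoid_add) \<Rightarrow> 'a poly \<Rightarrow> 'b" where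
  "poly_sum \<phi> P = (\<Sum>j\<le>degree P. \<phi> j (coeff P j))"

lemma poly_sum_atMost:
  assumes "\<And>j. \<phi> j 0 = 0" "degree P \<le> N"
  shows "poly_sum \<phi> P = (\<Sum>j\<le>N. \<phi> j (coeff P j))"
  unfolding poly_sum_def using assms
  by (intro sum.mono_neutral_left) (auto simp: coeff_eq_0)

lemma poly_sum_add:
  assumes "\<And>j a b. \<phi> j (a + b) = \<phi> j a + \<phi> j b" "\<And>j. \<phi> j 0 = 0"
  shows "poly_sum \<phi> (P + Q) = poly_sum \<phi> P + poly_sum \<phi> Q"
proof -
  let ?N = "max (degree P) (degree Q)"
  have "degree (P + Q) \<le> ?N" by (rule degree_add_le_max)
  then show ?thesis
    by (simp add: poly_sum_atMost[where N = ?N] assms sum.distrib)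
qed

lemma poly_sum_smult:
  fixes \<phi> :: "nat \<Rightarrow> 'a::comm_semiring_0 \<Rightarrow> 'b::comm_monoid_add"
  assumes "\<And>j. \<phi> j 0 = 0"
  shows "poly_sum \<phi> (smult c P) = poly_sum (\<lambda>j a. \<phi> j (c * a)) P"
  using assms degree_smult_le[of c P] by (simp add: poly_sum_atMost[where N = "degree P"])

text \<open>Multiplication by a variable is \<open>pCons 0\<close>, so this index shift becomes one
  further application of the corresponding operator in \<open>act_pX\<close> and
  \<open>act_pY\<close>.\<close>

lemma poly_sum_pCons:
  assumes "\<And>j. \<phi> j 0 = 0"
  shows "poly_sum \<phi> (pCons a P) = \<phi> 0 a + poly_sum (\<lambda>j. \<phi> (Suc j)) P"
  using assms degree_pCons_le[of a P]
  by (simp add: poly_sum_atMost[where N = "Suc (degree P)"] poly_sum_def[of _ P] sum.atMost_Suc_shift del: sum.atMost_Suc)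

definition pX :: "complex poly poly" where "pX = [:[:0, 1:]:]"
definition pY :: "complex poly poly" where "pY = [:0, 1:]"
definition pC :: "complex \<Rightarrow> complex poly poly" where "pC c = [:[:c:]:]"

lemma pC_simps: "pC (a + b) = pC a + pC b" "pC (a - b) = pC a - pC b" "pC (- a) = - pC a"
  "pC (a * b) = pC a * pC b" "pC 0 = 0" "pC 1 = 1" "pC (numeral k) = numeral k"
  by (simp_all add: pC_def numeral_poly flip: one_pCons)

text \<open>The inner variable of a bivariate polynomial stands for \<open>delta1\<close>, the outer one for
  \<open>delta2\<close>. Without commutation, \<open>act\<close> is not multiplicative; on holomorphic functions it is a
  module action by \<open>delta1_act\<close> and \<open>delta2_act\<close>.\<close>

definition act :: "complex poly poly \<Rightarrow> fn2 \<Rightarrow> fn2" where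
  "act P f p = poly_sum (\<lambda>j. poly_sum (\<lambda>i c. c * (delta1 ^^ i) ((delta2 ^^ j) f) p)) P"

lemma poly_sum_0 [simp]: "(\<And>j. \<phi> j 0 = 0) \<Longrightarrow> poly_sum \<phi> 0 = 0"
  by (simp add: poly_sum_def)

lemma act_add: "act (P + Q) f p = act P f p + act Q f p"
  unfolding act_def by (intro poly_sum_add) (simp_all add: distrib_right)

lemma poly_sum_times_left:
  fixes \<phi> :: "nat \<Rightarrow> 'a::zero \<Rightarrow> complex"
  shows "poly_sum (\<lambda>j a. c * \<phi> j a) P = c * poly_sum \<phi> P"
  by (simp add: poly_sum_def sum_distrib_left)

lemma act_pC: "act (pC c * P) f p = c * act P f p"
  by (simp add: act_def pC_def poly_sum_smult poly_sum_times_left mult.assoc)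

lemma act_1: "act 1 f p = f p"
  by (simp add: act_def one_pCons poly_sum_pCons)

lemma act_pX: "act (pX * P) f p = poly_sum (\<lambda>j. poly_sum (\<lambda>i c. c * (delta1 ^^ Suc i) ((delta2 ^^ j) f) p)) P"
  by (simp add: act_def pX_def poly_sum_smult poly_sum_pCons)

lemma act_pY: "act (pY * P) f p = poly_sum (\<lambda>j. poly_sum (\<lambda>i c. c * (delta1 ^^ i) ((delta2 ^^ Suc j) f) p)) P"
  by (simp add: act_def pY_def poly_sum_pCons)

lemma act_minus: "act (- P) f p = - act P f p"
  using act_pC[of "-1" P f p] by (simp add: pC_simps)

lemma act_diff: "act (P - Q) f p = act P f p - act Q f p"
  using act_add[of P "- Q" f p] by (simp add: act_minus)

lemma act_sum: "act (\<Sum>i\<in>I. F i) f p = (\<Sum>i\<in>I. act (F i) f p)"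
proof (induction I rule: infinite_finite_induct)
\<comment> \<open>The instance of \<open>act_pC\<close> with scalar 0 says that the zero polynomial
  acts as 0, which settles empty and infinite index sets.\<close>
qed (simp_all add: act_add act_pC[of 0 0, simplified pC_simps, simplified])

section \<open>The action of polynomials on a fixed holomorphic function\<close>

context
  fixes f :: fn2 and U :: "(complex \<times> complex) set"
  assumes f: "sep_holo f U"
begin

lemma open_dom: "open U" using f by (simp add: sep_holo_def)

lemma sep_holo_iter: "sep_holo ((delta1 ^^ i) ((delta2 ^^ j) f)) U"
proof -
  have "sep_holo ((delta2 ^^ j) f) U" by (induction j) (auto intro: sep_holo_delta2 f)
  then show ?thesis by (induction i) (auto intro: sep_holo_delta1)
qed

text \<open>Brings \<open>delta2\<close> past all powers of \<open>delta1\<close>, into the order of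
  composition fixed in \<open>act\<close>.\<close>

lemma delta2_iter:
  "p \<in> U \<Longrightarrow> delta2 ((delta1 ^^ i) ((delta2 ^^ j) f)) p = (delta1 ^^ i) ((delta2 ^^ Suc j) f) p"
proof (induction i arbitrary: p)
  case (Suc i)
  have "delta2 ((delta1 ^^ Suc i) ((delta2 ^^ j) f)) p = delta1 (delta2 ((delta1 ^^ i) ((delta2 ^^ j) f))) p"
    using delta2_delta1_commute[OF sep_holo_iter Suc.prems] by simp
  also have "\<dots> = delta1 ((delta1 ^^ i) ((delta2 ^^ Suc j) f)) p"
    by (rule delta1_cong[OF open_dom Suc.prems Suc.IH])
  finally show ?case by simp
qed simp

lemma sep_holo_act: "sep_holo (act P f) U"
  unfolding act_def[abs_def] poly_sum_def
  by (intro sep_holo_sum sep_holo_mult sep_holo_const sep_holo_iter open_dom)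

lemma delta1_act:
  assumes "p \<in> U" shows "delta1 (act P f) p = act (pX * P) f p"
proof -
  obtain x y where p: "p = (x, y)" by fastforce
  have "((\<lambda>s. act P f (s, y)) has_field_derivative
     poly_sum (\<lambda>j. poly_sum (\<lambda>i c. c * D1 ((delta1 ^^ i) ((delta2 ^^ j) f)) (x, y))) P) (at x)"
    unfolding act_def poly_sum_def
    using assms by (intro DERIV_sum DERIV_cmult sep_holo_D1[OF sep_holo_iter]) (simp add: p)
  then have "D1 (act P f) (x, y) = poly_sum (\<lambda>j. poly_sum (\<lambda>i c. c * D1 ((delta1 ^^ i) ((delta2 ^^ j) f)) (x, y))) P"
    by (simp add: D1_def[of "act P f"] DERIV_imp_deriv)
  then show ?thesis
    by (simp add: p delta1_def act_pX poly_sum_def sum_distrib_left mult.left_commute)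
qed

lemma delta2_act:
  assumes "p \<in> U" shows "delta2 (act P f) p = act (pY * P) f p"
proof -
  obtain x y where p: "p = (x, y)" by fastforce
  have "((\<lambda>s. act P f (x, s)) has_field_derivative
     poly_sum (\<lambda>j. poly_sum (\<lambda>i c. c * D2 ((delta1 ^^ i) ((delta2 ^^ j) f)) (x, y))) P) (at y)"
    unfolding act_def poly_sum_def
    using assms by (intro DERIV_sum DERIV_cmult sep_holo_D2[OF sep_holo_iter]) (simp add: p)
  then have "D2 (act P f) (x, y) = poly_sum (\<lambda>j. poly_sum (\<lambda>i c. c * D2 ((delta1 ^^ i) ((delta2 ^^ j) f)) (x, y))) P"
    by (simp add: D2_def[of "act P f"] DERIV_imp_deriv)
  then have "delta2 (act P f) p = poly_sum (\<lambda>j. poly_sum (\<lambda>i c. c * delta2 ((delta1 ^^ i) ((delta2 ^^ j) f)) p)) P"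
    by (simp add: p delta2_def poly_sum_def sum_distrib_left mult_ac)
  then show ?thesis
    using assms by (simp add: act_pY delta2_iter del: funpow.simps)
qed

lemma act_has_derivative:
  assumes "(t1, t2) \<in> U" "t1 \<noteq> 0" "t2 \<noteq> 1"
  shows "(act P f has_derivative (\<lambda>h. act (pX * P) f (t1, t2) / t1 * fst h
            + act (pY * P) f (t1, t2) / (t2 - 1) * snd h)) (at (t1, t2))"
proof -
  have "D1 (act P f) (t1, t2) = act (pX * P) f (t1, t2) / t1"
    using delta1_act[OF assms(1), of P] assms(2) by (simp add: delta1_def nonzero_eq_divide_eq mult_ac)
  moreover have "D2 (act P f) (t1, t2) = act (pY * P) f (t1, t2) / (t2 - 1)"
    using delta2_act[OF assms(1), of P] assms(3) by (simp add: delta2_def nonzero_eq_divide_eq mult_ac)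
  ultimately show ?thesis
    using sep_holo_has_derivative[OF sep_holo_act[of P] assms(1)] by simp
qed

lemma shiftop_delta1_act:
  assumes "\<And>p. p \<in> U \<Longrightarrow> h p = act P f p" "p \<in> U"
  shows "shiftop delta1 c h p = act ((pX + pC c) * P) f p"
  using delta1_cong[OF open_dom assms(2,1)] assms
  by (simp add: shiftop_def delta1_act distrib_right act_add act_pC)

lemma shiftop_delta2_act:
  assumes "\<And>p. p \<in> U \<Longrightarrow> h p = act P f p" "p \<in> U"
  shows "shiftop delta2 c h p = act ((pY + pC c) * P) f p"
  using delta2_cong[OF open_dom assms(2,1)] assms
  by (simp add: shiftop_def delta2_act distrib_right act_add act_pC)

text \<open>Replaces an ordered composition of operators by a product in a commutative ring, whose
  factors can then be rearranged freely.\<close>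

lemma opprod_act:
  assumes "\<And>p. p \<in> U \<Longrightarrow> h p = act P f p" "p \<in> U"
  shows "opprod (map (\<lambda>i. shiftop delta1 (c i)) [lo..<Suc hi]) h p
     = act ((\<Prod>i\<in>{lo..hi}. pX + pC (c i)) * P) f p"
proof -
  have "opprod (map (\<lambda>i. shiftop delta1 (c i)) xs) h p
     = act (prod_list (map (\<lambda>i. pX + pC (c i)) xs) * P) f p" if "p \<in> U" for xs p
    using that
  proof (induction xs arbitrary: p)
    case (Cons x xs)
    show ?case
      using shiftop_delta1_act[OF Cons.IH Cons.prems] by (simp add: opprod_def mult.assoc)
  qed (simp add: opprod_def assms)
  from this[OF assms(2), of "[lo..<Suc hi]"] show ?thesis
    by (simp add: prod.distinct_set_conv_list[symmetric] atLeastLessThanSuc_atLeastAtMost del: upt_Suc)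
qed

end

section \<open>Rows of the residue matrices\<close>

definition row_sum :: "nat \<Rightarrow> (nat \<Rightarrow> nat \<Rightarrow> complex) \<Rightarrow> (nat \<Rightarrow> complex) \<Rightarrow> nat \<Rightarrow> complex" where
  "row_sum m M w k = (\<Sum>j=0..m. M k j * w j)"

lemma row_sum_add: "row_sum m (M + N) w k = row_sum m M w k + row_sum m N w k"
  by (simp add: row_sum_def distrib_right sum.distrib)

lemma row_sum_diff: "row_sum m (M - N) w k = row_sum m M w k - row_sum m N w k"
  by (simp add: row_sum_def left_diff_distrib sum_subtractf fun_diff_def)

lemma row_sum_minus: "row_sum m (- M) w k = - row_sum m M w k"
  by (simp add: row_sum_def sum_negf)

lemma row_sum_sum: "row_sum m (\<Sum>i\<in>I. F i) w k = (\<Sum>i\<in>I. row_sum m (F i) w k)"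
  by (induction I rule: infinite_finite_induct) (simp_all add: row_sum_def distrib_right sum.distrib)

lemma row_sum_sm: "row_sum m (sm c M) w k = c * row_sum m M w k"
  by (simp add: row_sum_def sm_def sum_distrib_left mult.assoc)

lemma row_sum_Em:
  assumes "\<And>j. j > m \<Longrightarrow> w j = 0"
  shows "row_sum m (Em i j) w k = of_bool (k = i) * w j"
proof (cases "j \<le> m")
  case True
  then show ?thesis
    by (simp add: row_sum_def Em_def of_bool_def if_distrib[of "\<lambda>x. x * _"] cong: if_cong)
next
  case False
  then show ?thesis
    using assms by (auto simp: row_sum_def Em_def intro!: sum.neutral)
qed

lemma sum_of_bool_eq:
  fixes f :: "nat \<Rightarrow> complex"
  assumes "finite I"
  shows "(\<Sum>i\<in>I. of_bool (k = i) * f i) = of_bool (k \<in> I) * f k"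
    and "(\<Sum>i\<in>I. of_bool (k = n + i) * f i) = of_bool (\<exists>i\<in>I. k = n + i) * f (k - n)"
proof -
  show 1: "(\<Sum>i\<in>I. of_bool (k = i) * f i) = of_bool (k \<in> I) * f k" for f :: "nat \<Rightarrow> complex" and k
    using assms by (simp add: of_bool_def if_distrib[of "\<lambda>x. x * _"] cong: if_cong)
  \<comment> \<open>Subtraction on naturals truncates, so for k < n the condition
    \<open>k - n = i\<close> would be met by i = 0; the guard \<open>k \<ge> n\<close> removes this
    case.\<close>
  have "(\<Sum>i\<in>I. of_bool (k = n + i) * f i) = (\<Sum>i\<in>I. of_bool (k - n = i) * (of_bool (k \<ge> n) * f i))"
    by (intro sum.cong) auto
  also have "\<dots> = of_bool (\<exists>i\<in>I. k = n + i) * f (k - n)"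
    using assms by (subst 1) (auto simp: le_iff_add)
  finally show "(\<Sum>i\<in>I. of_bool (k = n + i) * f i) = of_bool (\<exists>i\<in>I. k = n + i) * f (k - n)" .
qed

lemmas row_sum_simps = row_sum_add row_sum_diff row_sum_minus row_sum_sm row_sum_sum

text \<open>Cutting \<open>w\<close> off beyond \<open>2 * n\<close> makes the evaluation of \<open>Em i j\<close> unconditional in \<open>j\<close>.\<close>

context
  fixes n :: nat and th2 th3 :: complex and kappa rho w :: "nat \<Rightarrow> complex"
  assumes w: "\<And>j. j > 2 * n \<Longrightarrow> w j = 0"
begin

lemma row_sum_Em_w: "row_sum (2 * n) (Em i j) w k = of_bool (k = i) * w j"
  by (rule row_sum_Em) (rule w)

text \<open>All rows of \<open>A11\<close> are multiples of its row 0, so the pole at t1 = 1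
  involves a single linear form in \<open>w\<close>.\<close>

lemma row_sum_A11:
  "row_sum (2 * n) (A11 n th2 th3 kappa rho) w k =
     of_bool (k = 0) * (th3 * w 0 + (\<Sum>j=1..n. w j))
   + of_bool (k \<in> {1..n}) * ((kappa k + rho k) * (th3 * w 0 + (\<Sum>j=1..n. w j)))"
proof -
  have "row_sum (2 * n) (A11 n th2 th3 kappa rho) w k =
     of_bool (k = 0) * (th3 * w 0 + (\<Sum>j=1..n. w j))
   + (\<Sum>i=1..n. of_bool (k = i) * ((kappa i + rho i) * (th3 * w 0 + (\<Sum>j=1..n. w j))))"
    unfolding A11_def row_sum_simps row_sum_Em_w
    by (simp only: sum_distrib_left ring_distribs sum.distrib sum_subtractf mult_ac
        mult_minus_left mult_minus_right)
  then show ?thesis by (simp add: sum_of_bool_eq)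
qed

lemma row_sum_A01:
  "row_sum (2 * n) (A01 n th2 th3 kappa rho) w k =
     of_bool (k = 0) * ((kappa 0 + rho 1) * w 0 - (\<Sum>j=1..n. w j) - (\<Sum>j=1..n. w (n + j)))
   + of_bool (k \<in> {1..n}) * ((rho 1 - rho k) * w k - (kappa k + rho k) * (\<Sum>j=k+1..n. w j))
   + of_bool (\<exists>i\<in>{1..n}. k = n + i) * ((rho 1 - rho (k - n)) * w (n + (k - n))
       - (kappa (k - n) + rho (k - n)) * (\<Sum>j=(k-n)+1..n. w (n + j)))"
proof -
  have "row_sum (2 * n) (A01 n th2 th3 kappa rho) w k =
     of_bool (k = 0) * ((kappa 0 + rho 1) * w 0 - (\<Sum>j=1..n. w j) - (\<Sum>j=1..n. w (n + j)))
   + (\<Sum>i=1..n. of_bool (k = i) * ((rho 1 - rho i) * w i - (kappa i + rho i) * (\<Sum>j=i+1..n. w j)))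
   + (\<Sum>i=1..n. of_bool (k = n + i) * ((rho 1 - rho i) * w (n + i)
       - (kappa i + rho i) * (\<Sum>j=i+1..n. w (n + j))))"
    unfolding A01_def row_sum_simps row_sum_Em_w
    by (simp only: sum_distrib_left ring_distribs sum.distrib sum_subtractf mult_ac
        mult_minus_left mult_minus_right)
  then show ?thesis by (simp only: sum_of_bool_eq finite_atLeastAtMost)
qed

text \<open>As with \<open>A11\<close>, all rows are multiples of row 0, so one linear form governs
  the pole at t1 = t2.\<close>

lemma row_sum_At:
  "row_sum (2 * n) (At n th2 th3 kappa rho) w k =
     of_bool (k = 0) * (th2 * w 0 + (\<Sum>j=1..n. w (n + j)))
   + of_bool (\<exists>i\<in>{1..n}. k = n + i) * ((kappa (k - n) + rho (k - n)) * (th2 * w 0 + (\<Sum>j=1..n. w (n + j))))"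
proof -
  have "row_sum (2 * n) (At n th2 th3 kappa rho) w k =
     of_bool (k = 0) * (th2 * w 0 + (\<Sum>j=1..n. w (n + j)))
   + (\<Sum>i=1..n. of_bool (k = n + i) * ((kappa i + rho i) * (th2 * w 0 + (\<Sum>j=1..n. w (n + j)))))"
    unfolding At_def row_sum_simps row_sum_Em_w
    by (simp only: sum_distrib_left ring_distribs sum.distrib sum_subtractf mult_ac
        mult_minus_left mult_minus_right)
  then show ?thesis by (simp only: sum_of_bool_eq finite_atLeastAtMost)
qed

lemma row_sum_A12:
  "row_sum (2 * n) (A12 n th2 th3 kappa rho) w k =
     of_bool (k \<in> {1..n}) * (th2 * w k - th3 * w (n + k))
   + of_bool (\<exists>i\<in>{1..n}. k = n + i) * (- th2 * w (k - n) + th3 * w (n + (k - n)))"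
proof -
  have "row_sum (2 * n) (A12 n th2 th3 kappa rho) w k =
     (\<Sum>i=1..n. of_bool (k = i) * (th2 * w i - th3 * w (n + i)))
   + (\<Sum>i=1..n. of_bool (k = n + i) * (- th2 * w i + th3 * w (n + i)))"
    unfolding A12_def row_sum_simps row_sum_Em_w
    by (simp only: sum_distrib_left ring_distribs sum.distrib sum_subtractf mult_ac
        mult_minus_left mult_minus_right)
  then show ?thesis by (simp only: sum_of_bool_eq finite_atLeastAtMost)
qed

lemma row_sum_A02:
  "row_sum (2 * n) (A02 n th2 th3 kappa rho) w k =
     of_bool (\<exists>i\<in>{1..n}. k = n + i) * (- (th2 * (kappa (k - n) + rho (k - n))) * w 0 + th2 * w (k - n)
       - (kappa (k - n) + rho (k - n)) * (\<Sum>j=1..(k-n)-1. w (n + j))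
       + (th2 + kappa 0 - kappa (k - n)) * w (n + (k - n)))"
proof -
  have "row_sum (2 * n) (A02 n th2 th3 kappa rho) w k =
     (\<Sum>i=1..n. of_bool (k = n + i) * (- (th2 * (kappa i + rho i)) * w 0 + th2 * w i
       - (kappa i + rho i) * (\<Sum>j=1..i-1. w (n + j)) + (th2 + kappa 0 - kappa i) * w (n + i)))"
    unfolding A02_def row_sum_simps row_sum_Em_w
    by (simp only: sum_distrib_left ring_distribs sum.distrib sum_subtractf mult_ac
        mult_minus_left mult_minus_right)
  then show ?thesis by (simp only: sum_of_bool_eq finite_atLeastAtMost)
qed

end

section \<open>The Pfaff system\<close>

locale pfaff =
  fixes n :: nat and th2 th3 :: complex and kappa rho :: "nat \<Rightarrow> complex"
    and z :: fn2 and U :: "(complex \<times> complex) set"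
  assumes n: "n \<ge> 1"
    and z: "sep_holo z U"
    and eq1: "\<And>p. p \<in> U \<Longrightarrow> eq1 n th2 th3 kappa rho z p = 0"
    and eq2: "\<And>p. p \<in> U \<Longrightarrow> eq2 th2 th3 kappa rho z p = 0"
begin

definition B :: "nat \<Rightarrow> complex poly poly" where
  "B l = (\<Prod>i\<in>{l..n}. pX + pC (bpar kappa rho i))"

definition C :: "nat \<Rightarrow> complex poly poly" where
  "C h = (\<Prod>i\<in>{1..h}. pX + pC (cpar kappa rho i - 1))"

text \<open>The exception at 1 reflects w_1, which has the factor X + c_1 - 1 where the pattern for
  i >= 2 would give X.\<close>

definition Q :: "nat \<Rightarrow> complex poly poly" where
  "Q i = (if i = 1 then B 2 * (pX + pC (cpar kappa rho 1 - 1)) else B (i + 1) * (C (i - 1) * pX))"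

definition Yb :: "complex poly poly" where "Yb = pY + pC (bprime th2)"
definition Yc :: "complex poly poly" where "Yc = pY + pC (cprime th2 th3 - 1)"
definition E :: "complex poly poly" where "E = pX + pY + pC (cpar kappa rho 1 + cprime th2 th3 - 2)"
definition D :: "complex poly poly" where "D = B 1 * (pX + pC (cpar kappa rho 1 - 1))"
definition T :: "complex poly poly" where "T = pX * C n"
definition e :: "nat \<Rightarrow> complex" where "e i = kappa i + rho i"

text \<open>The prefactors become uniform in the index: b_1 = - e_1, b_i - c_i + 1 = - e_i for i >=
  2, and b' - c' + 1 = theta_3.\<close>

definition W :: "nat \<Rightarrow> complex poly poly" where
  "W k = (if k = 0 then - (B 1 * Yc)
          else if k \<le> n then pC (th3 * e k) * Q k
          else - (pC (e (k - n)) * (Q (k - n) * Yb)))"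

section \<open>Polynomial identities: recursion and telescoping of the \<open>Q i\<close>\<close>

lemma B_Suc: "l \<le> n \<Longrightarrow> B l = (pX + pC (bpar kappa rho l)) * B (Suc l)"
  by (simp add: B_def prod.atLeast_Suc_atMost)

lemma B_empty: "B (Suc n) = 1"
  by (simp add: B_def)

lemma C_Suc: "C (Suc h) = (pX + pC (cpar kappa rho (Suc h) - 1)) * C h"
  by (simp add: C_def mult.commute)

lemma C_0: "C 0 = 1"
  by (simp add: C_def)

text \<open>From i to i + 1 the factor X + b_{i+1} of \<open>B\<close> is exchanged for X + c_i - 1,
  and c_i - 1 = rho_i - rho_1 when i >= 2. For i = 1 the factor gained is X itself, matching rho_1 -
  rho_1 = 0.\<close>

lemma Q_next:
  assumes "1 \<le> i" "i < n"
  shows "(pX + pC (rho i - rho 1)) * Q i = (pX + pC (bpar kappa rho (Suc i))) * Q (Suc i)"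
proof (cases "i = 1")
  case True
  then show ?thesis using assms B_Suc[of 2] C_Suc[of 0]
    by (simp add: Q_def C_0 pC_simps numeral_2_eq_2 mult_ac)
next
  case False
  then obtain h where h: "i = Suc h" "h \<noteq> 0" using assms by (cases i) auto
  then show ?thesis using assms B_Suc[of "Suc i"] C_Suc[of h]
    by (simp add: Q_def cpar_def mult_ac)
qed

lemma Q_last: "(pX + pC (rho n - rho 1)) * Q n = T"
proof (cases "n = 1")
  case True
  then show ?thesis
    unfolding Q_def T_def using B_empty C_Suc[of 0] by (simp add: C_0 pC_simps numeral_2_eq_2)
next
  case False
  then obtain h where h: "n = Suc h" "h \<noteq> 0" using n by (cases n) auto
  then show ?thesis
    unfolding Q_def T_def using B_empty C_Suc[of h] by (simp add: cpar_def mult_ac)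
qed

lemma Q_first: "(pX + pC (bpar kappa rho 1)) * Q 1 = D"
  using n B_Suc[of 1] by (simp add: Q_def D_def numeral_2_eq_2 mult_ac)

text \<open>The two linear factors attached to \<open>Q i\<close> differ by a constant, which turns
  the product relation \<open>Q_next\<close> into a telescoping sum.\<close>

lemma pX_bpar: "pX + pC (bpar kappa rho i) = (pX + pC (rho i - rho 1)) - pC (e i)"
  by (simp add: bpar_def e_def pC_simps)

lemma Q_telescope:
  assumes "1 \<le> i" "i \<le> n"
  shows "(pX + pC (rho i - rho 1)) * Q i = T - (\<Sum>j=Suc i..n. pC (e j) * Q j)"
  using assms(2,1)
proof (induction i rule: inc_induct)
  case base
  show ?case using Q_last by simp
next
  case (step i)
  have "(pX + pC (rho i - rho 1)) * Q i = (pX + pC (rho (Suc i) - rho 1)) * Q (Suc i) - pC (e (Suc i)) * Q (Suc i)"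
    using step Q_next[of i] by (simp add: pX_bpar left_diff_distrib)
  also have "\<dots> = T - (\<Sum>j=Suc i..n. pC (e j) * Q j)"
    using step by (simp add: sum.atLeast_Suc_atMost[of "Suc i"])
  finally show ?case .
qed

lemma pX_Q:
  assumes "i \<in> {1..n}"
  shows "pX * Q i = T + pC (rho 1 - rho i) * Q i - (\<Sum>j=Suc i..n. pC (e j) * Q j)"
  using Q_telescope[of i] assms by (simp add: pC_simps algebra_simps)

lemma T_eq: "T = D + (\<Sum>j=1..n. pC (e j) * Q j)"
proof -
  \<comment> \<open>The lower end of the telescope, where \<open>Q_first\<close> supplies
    \<open>D\<close>.\<close>
  have "D = (pX + pC (rho 1 - rho 1)) * Q 1 - pC (e 1) * Q 1"
    unfolding Q_first[symmetric] pX_bpar by (simp add: left_diff_distrib)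
  then show ?thesis
    using n Q_telescope[of 1] by (simp add: sum.atLeast_Suc_atMost[of "Suc 0"] pC_simps)
qed

lemma Yb_eq: "pY = Yb + pC th2" and Yc_eq: "Yc = Yb - pC th3"
  by (simp_all add: Yb_def Yc_def bprime_def cprime_def pC_simps)

text \<open>\<open>E\<close> is the sum of X + c_1 - 1 and \<open>Yc\<close>.\<close>

lemma E_D: "E * B 1 = D + B 1 * Yc"
  unfolding E_def D_def Yc_def by (simp add: pC_simps algebra_simps)

lemma pX_eq: "pX = (pX + pC (cpar kappa rho 1 - 1)) + pC (kappa 0 + rho 1)"
  by (simp add: cpar_def pC_simps)

section \<open>The equations and the vector w in terms of the polynomial action\<close>

abbreviation L :: "complex poly poly \<Rightarrow> fn2" where "L P \<equiv> act P z"

lemmas L_simps = act_add act_diff act_minus act_pC act_sum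

lemmas zU = open_dom[OF z]

lemma L_1: "z p = L 1 p" by (simp add: act_1)

lemma opprod_bpar:
  assumes "\<And>p. p \<in> U \<Longrightarrow> h p = L P p" "p \<in> U"
  shows "opprod (map (\<lambda>i. shiftop delta1 (bpar kappa rho i)) [l..<Suc n]) h p = L (B l * P) p"
  unfolding B_def by (rule opprod_act[OF z assms])

lemma opprod_cpar:
  assumes "\<And>p. p \<in> U \<Longrightarrow> h p = L P p" "p \<in> U"
  shows "opprod (map (\<lambda>i. shiftop delta1 (cpar kappa rho i - 1)) [1..<Suc m]) h p = L (C m * P) p"
  unfolding C_def by (rule opprod_act[OF z assms])

lemma L_E:
  assumes "\<And>p. p \<in> U \<Longrightarrow> h p = L P p" "p \<in> U"
  shows "delta1 h p + delta2 h p + (cpar kappa rho 1 + cprime th2 th3 - 2) * h p = L (E * P) p"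
  using delta1_cong[OF zU assms(2,1)] delta2_cong[OF zU assms(2,1)] assms
  by (simp add: E_def distrib_right L_simps delta1_act[OF z] delta2_act[OF z])

lemma L_eq1:
  assumes "p \<in> U" shows "fst p * L (E * B 1) p = L T p"
proof -
  have B: "opprod (map (\<lambda>i. shiftop delta1 (bpar kappa rho i)) [1..<Suc n]) z q = L (B 1) q" if "q \<in> U" for q
    using opprod_bpar[OF L_1 that, of 1] by simp
  have C: "opprod (map (\<lambda>i. shiftop delta1 (cpar kappa rho i - 1)) [1..<Suc n]) z q = L (C n) q" if "q \<in> U" for q
    using opprod_cpar[OF L_1 that] by simp
  have "delta1 (opprod (map (\<lambda>i. shiftop delta1 (cpar kappa rho i - 1)) [1..<Suc n]) z) p = L T p"
    using delta1_cong[OF zU assms C] delta1_act[OF z assms] by (simp add: T_def)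
  then show ?thesis
    using eq1[OF assms] L_E[OF B assms] by (simp add: eq1_def Let_def del: upt_Suc)
qed

lemma L_eq2:
  assumes "p \<in> U" shows "(1 - snd p) * L (E * Yb) p = L (pY * Yc) p"
proof -
  have b: "shiftop delta2 (bprime th2) z q = L Yb q" if "q \<in> U" for q
    using shiftop_delta2_act[OF z L_1 that] by (simp add: Yb_def)
  have c: "shiftop delta2 (cprime th2 th3 - 1) z q = L Yc q" if "q \<in> U" for q
    using shiftop_delta2_act[OF z L_1 that] by (simp add: Yc_def)
  have "delta2 (shiftop delta2 (cprime th2 th3 - 1) z) p = L (pY * Yc) p"
    using delta2_cong[OF zU assms c] delta2_act[OF z assms] by simp
  then show ?thesis
    using eq2[OF assms] L_E[OF b assms] by (simp add: eq2_def Let_def)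
qed

text \<open>The coefficient t1 is constant for \<open>delta2\<close>, so an equation with this
  coefficient may be multiplied by Y. \<open>L_pX_mult\<close> is the counterpart for 1 - t2 and
  X.\<close>

lemma L_pY_mult:
  assumes "\<And>p. p \<in> U \<Longrightarrow> fst p * L R p = L S p" "p \<in> U"
  shows "fst p * L (pY * R) p = L (pY * S) p"
proof -
  obtain x y where p: "p = (x, y)" by fastforce
  have "((\<lambda>s. x * L R (x, s)) has_field_derivative x * D2 (L R) (x, y)) (at y)"
    using assms(2) by (intro DERIV_cmult sep_holo_D2[OF sep_holo_act[OF z]]) (simp add: p)
  then have "delta2 (\<lambda>p. fst p * L R p) p = fst p * delta2 (L R) p"
    by (simp add: p delta2_def D2_def[of "\<lambda>p. fst p * L R p"] DERIV_imp_deriv)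
  then show ?thesis
    using delta2_cong[OF zU assms(2,1)] delta2_act[OF z assms(2)] by simp
qed

lemma L_pX_mult:
  assumes "\<And>p. p \<in> U \<Longrightarrow> (1 - snd p) * L R p = L S p" "p \<in> U"
  shows "(1 - snd p) * L (pX * R) p = L (pX * S) p"
proof -
  obtain x y where p: "p = (x, y)" by fastforce
  have "((\<lambda>s. (1 - y) * L R (s, y)) has_field_derivative (1 - y) * D1 (L R) (x, y)) (at x)"
    using assms(2) by (intro DERIV_cmult sep_holo_D1[OF sep_holo_act[OF z]]) (simp add: p)
  then have "delta1 (\<lambda>p. (1 - snd p) * L R p) p = (1 - snd p) * delta1 (L R) p"
    by (simp add: p delta1_def D1_def[of "\<lambda>p. (1 - snd p) * L R p"] DERIV_imp_deriv)
  then show ?thesis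
    using delta1_cong[OF zU assms(2,1)] delta1_act[OF z assms(2)] by simp
qed

lemma L_shift_mult:
  assumes "\<And>p. p \<in> U \<Longrightarrow> (1 - snd p) * L R p = L S p" "p \<in> U"
  shows "(1 - snd p) * L ((pX + pC c) * R) p = L ((pX + pC c) * S) p"
  using L_pX_mult[OF assms] assms(1)[OF assms(2)]
  unfolding distrib_right L_simps distrib_left mult.left_commute[of _ c] by simp

lemma L_prod_mult:
  assumes "\<And>p. p \<in> U \<Longrightarrow> (1 - snd p) * L R p = L S p" "p \<in> U"
  shows "(1 - snd p) * L ((\<Prod>i\<in>I. pX + pC (c i)) * R) p = L ((\<Prod>i\<in>I. pX + pC (c i)) * S) p"
  using assms(2)
proof (induction I arbitrary: p rule: infinite_finite_induct)
  case (insert i I)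
  then show ?case using L_shift_mult[OF insert.IH insert.prems] by (simp add: mult.assoc)
qed (simp_all add: assms(1))

lemma L_B_mult:
  assumes "\<And>p. p \<in> U \<Longrightarrow> (1 - snd p) * L R p = L S p" "p \<in> U"
  shows "(1 - snd p) * L (B l * R) p = L (B l * S) p"
  unfolding B_def by (rule L_prod_mult[OF assms])

text \<open>\<open>Q i\<close> is a product of factors in X alone, and each of them commutes with
  multiplication by 1 - t2.\<close>

lemma L_Q_mult:
  assumes "\<And>p. p \<in> U \<Longrightarrow> (1 - snd p) * L R p = L S p" "p \<in> U"
  shows "(1 - snd p) * L (Q i * R) p = L (Q i * S) p"
proof -
  have "(1 - snd p) * L (B 2 * ((pX + pC c) * R)) p = L (B 2 * ((pX + pC c) * S)) p" for c
    by (rule L_B_mult[OF L_shift_mult[OF assms(1)] assms(2)])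
  moreover have "(1 - snd p) * L (B (i + 1) * (C (i - 1) * (pX * R))) p = L (B (i + 1) * (C (i - 1) * (pX * S))) p"
    unfolding C_def by (rule L_B_mult[OF L_prod_mult[OF L_pX_mult[OF assms(1)]] assms(2)])
  ultimately show ?thesis by (simp add: Q_def mult.assoc)
qed

lemma wvec_eq:
  assumes k: "k \<le> 2 * n" and p: "p \<in> U"
  shows "wvec n th2 th3 kappa rho z k p = L (W k) p"
proof -
  have b: "shiftop delta2 (bprime th2) z q = L Yb q" if "q \<in> U" for q
    using shiftop_delta2_act[OF z L_1 that] by (simp add: Yb_def)
  have c: "shiftop delta2 (cprime th2 th3 - 1) z q = L Yc q" if "q \<in> U" for q
    using shiftop_delta2_act[OF z L_1 that] by (simp add: Yc_def)
  have th3: "bprime th2 - cprime th2 th3 + 1 = th3"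
    by (simp add: bprime_def cprime_def)
  have e1: "bpar kappa rho 1 = - e 1"
    by (simp add: bpar_def e_def)
  have ei: "bpar kappa rho i - cpar kappa rho i + 1 = - e i" if "i \<noteq> 1" for i
    using that by (simp add: bpar_def cpar_def e_def)
  have ei': "cpar kappa rho i - bpar kappa rho i - 1 = e i" if "i \<noteq> 1" for i
    using that by (simp add: bpar_def cpar_def e_def)
  have Q1: "opprod (map (\<lambda>i. shiftop delta1 (bpar kappa rho i)) [2..<Suc n])
      (shiftop delta1 (cpar kappa rho 1 - 1) h) p = L (Q 1 * R) p"
    if "\<And>q. q \<in> U \<Longrightarrow> h q = L R q" for h R
    using opprod_bpar[OF shiftop_delta1_act[OF z that] p] by (simp add: Q_def mult.assoc)
  have Qi: "opprod (map (\<lambda>j. shiftop delta1 (bpar kappa rho j)) [Suc i..<Suc n])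
      (opprod (map (\<lambda>j. shiftop delta1 (cpar kappa rho j - 1)) [1..<Suc (i - 1)]) (delta1 h)) p = L (Q i * R) p"
    if "i \<noteq> 1" "\<And>q. q \<in> U \<Longrightarrow> h q = L R q" for i h R
  proof -
    have "delta1 h q = L (pX * R) q" if "q \<in> U" for q
      using delta1_cong[OF zU \<open>q \<in> U\<close>, of h "L R"] \<open>\<And>q. q \<in> U \<Longrightarrow> h q = L R q\<close> delta1_act[OF z \<open>q \<in> U\<close>] by simp
    from opprod_bpar[OF opprod_cpar[OF this] p] show ?thesis
      using \<open>i \<noteq> 1\<close> by (simp add: Q_def mult.assoc)
  qed
  consider "k = 0" | "k = 1" | "k \<noteq> 0" "k \<noteq> 1" "k \<le> n" | "k = n + 1" | "k > n + 1"
    by linarith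
  then show ?thesis
  proof cases
    case 1
    then show ?thesis using opprod_bpar[OF c p, of 1]
      by (simp add: wvec_def Let_def scal_def W_def L_simps del: upt_Suc)
  next
    case 2
    then show ?thesis using n Q1[OF L_1] e1
      by (simp add: wvec_def Let_def scal_def W_def L_simps th3 mult.commute[of th3] del: upt_Suc)
  next
    case 3
    then show ?thesis using Qi[OF _ L_1, of k] ei'[of k]
      by (simp add: wvec_def Let_def scal_def W_def L_simps th3 mult.commute[of th3] del: upt_Suc)
  next
    case 4
    then show ?thesis using n Q1[OF b] e1
      by (simp add: wvec_def Let_def scal_def W_def L_simps del: upt_Suc)
  next
    case 5
    then show ?thesis using n Qi[OF _ b, of "k - n"] ei[of "k - n"]
      by (simp add: wvec_def Let_def scal_def W_def L_simps Suc_diff_le del: upt_Suc)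
  qed
qed

section \<open>Evaluation at a point off the singular lines\<close>

context
  fixes t1 t2 :: complex
  assumes t: "(t1, t2) \<in> U" "t1 \<noteq> 0" "t1 \<noteq> 1" "t2 \<noteq> 0" "t2 \<noteq> 1" "t1 \<noteq> t2"
begin

definition "w k = (if k \<le> 2 * n then L (W k) (t1, t2) else 0)"

abbreviation "q i \<equiv> L (Q i) (t1, t2)"
abbreviation "q' i \<equiv> L (Q i * Yb) (t1, t2)"
text \<open>\<open>s\<close> will carry the pole at t1 = 1, and its analogue \<open>s'\<close> for y
  the pole at t1 = t2.\<close>

abbreviation "s \<equiv> L (E * B 1) (t1, t2)"
abbreviation "s' \<equiv> L (E * B 1 * Yb) (t1, t2)"
abbreviation "lam R \<equiv> L R (t1, t2)"

lemma w_0: "w 0 = - lam (B 1 * Yc)"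
  by (simp add: w_def W_def L_simps)

lemma w_le: "i \<in> {1..n} \<Longrightarrow> w i = th3 * e i * q i"
  by (simp add: w_def W_def L_simps)

lemma w_gt: "i \<in> {1..n} \<Longrightarrow> w (n + i) = - (e i * q' i)"
  by (auto simp add: w_def W_def L_simps)

lemma sum_w_le: "m \<le> n \<Longrightarrow> (\<Sum>j=Suc l..m. w j) = th3 * (\<Sum>j=Suc l..m. e j * q j)"
  unfolding sum_distrib_left by (intro sum.cong) (auto simp: w_le)

lemma sum_w_gt: "m \<le> n \<Longrightarrow> (\<Sum>j=Suc l..m. w (n + j)) = - (\<Sum>j=Suc l..m. e j * q' j)"
  unfolding sum_negf[symmetric] by (intro sum.cong) (auto simp: w_gt)

lemma t1_s: "t1 * s = lam T"
  using L_eq1[OF t(1)] by simp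

text \<open>The first equation for y, obtained by multiplying the one for z by Y + b'.\<close>

lemma t1_s': "t1 * s' = lam (T * Yb)"
proof -
  have "t1 * lam (pY * (E * B 1)) = lam (pY * T)"
    using L_pY_mult[OF L_eq1 t(1)] by simp
  then have "t1 * lam ((pY + pC (bprime th2)) * (E * B 1)) = lam ((pY + pC (bprime th2)) * T)"
    using t1_s unfolding distrib_right L_simps distrib_left mult.left_commute[of _ "bprime th2"] by simp
  then show ?thesis by (simp add: Yb_def mult.commute)
qed

lemma lam_T: "lam T = lam D + (\<Sum>j=1..n. e j * q j)"
  unfolding T_eq by (simp add: L_simps)

lemma lam_T_Yb: "lam (T * Yb) = lam (D * Yb) + (\<Sum>j=1..n. e j * q' j)"
  unfolding T_eq by (simp add: L_simps distrib_right sum_distrib_right mult.assoc)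

lemma s_eq: "(t1 - 1) * s = w 0 + (\<Sum>j=1..n. e j * q j)"
  unfolding left_diff_distrib t1_s lam_T w_0 by (simp only: E_D L_simps) simp

lemma s'_eq: "(t1 - t2) * s' = (\<Sum>j=1..n. e j * q' j) - th2 * w 0"
proof -
  have "(1 - t2) * lam (B 1 * (E * Yb)) = lam (B 1 * (pY * Yc))"
    using L_B_mult[OF L_eq2 t(1)] by simp
  also have "B 1 * (pY * Yc) = B 1 * Yc * Yb + pC th2 * (B 1 * Yc)"
    by (simp add: Yb_eq algebra_simps)
  finally have 1: "(1 - t2) * s' = lam (B 1 * Yc * Yb) - th2 * w 0"
    by (simp add: L_simps w_0 mult_ac)
  have 2: "s' = lam (D * Yb) + lam (B 1 * Yc * Yb)"
    unfolding E_D by (simp add: L_simps distrib_right)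
  \<comment> \<open>The first equation evaluates t1 s' and the second (1 - t2) s'; subtracting s' in
    the form given by \<open>E_D\<close> cancels the terms in \<open>D * Yb\<close> and
    \<open>B 1 * Yc * Yb\<close>.\<close>
  have "(t1 - t2) * s' = t1 * s' - s' + (1 - t2) * s'"
    by (simp add: algebra_simps)
  also have "\<dots> = (\<Sum>j=1..n. e j * q' j) - th2 * w 0"
    unfolding 1 t1_s' lam_T_Yb using 2 by simp
  finally show ?thesis .
qed

lemma s_div: "s = (w 0 + (\<Sum>j=1..n. e j * q j)) / (t1 - 1)"
  and s'_div: "s' = ((\<Sum>j=1..n. e j * q' j) - th2 * w 0) / (t1 - t2)"
  using s_eq s'_eq t by (simp_all add: nonzero_eq_divide_eq mult.commute)

lemma lam_pX_Q:
  "i \<in> {1..n} \<Longrightarrow> lam (pX * Q i) = t1 * s + (rho 1 - rho i) * q i - (\<Sum>j=Suc i..n. e j * q j)"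
  by (simp only: pX_Q L_simps t1_s)

lemma lam_pX_Q_Yb:
  assumes "i \<in> {1..n}"
  shows "lam (pX * (Q i * Yb)) = t1 * s' + (rho 1 - rho i) * q' i - (\<Sum>j=Suc i..n. e j * q' j)"
proof -
  have "pX * (Q i * Yb) = T * Yb + pC (rho 1 - rho i) * (Q i * Yb) - (\<Sum>j=Suc i..n. pC (e j) * (Q j * Yb))"
    unfolding mult.assoc[symmetric] pX_Q[OF assms] by (simp add: algebra_simps sum_distrib_left)
  then show ?thesis by (simp only: L_simps t1_s')
qed

text \<open>\<open>pX_eq\<close> splits X so that X \<open>B 1\<close> becomes \<open>D\<close> plus
  a multiple of \<open>B 1\<close>, and \<open>Yc\<close> is \<open>Yb\<close> minus theta_3;
  \<open>lam_T\<close> and \<open>lam_T_Yb\<close> then express the two terms in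
  \<open>D\<close>.\<close>

lemma lam_pX_W0:
  "lam (pX * W 0) = (kappa 0 + rho 1) * w 0 + th3 * (t1 * s - (\<Sum>j=1..n. e j * q j))
     - (t1 * s' - (\<Sum>j=1..n. e j * q' j))"
proof -
  have "pX * W 0 = - (D * Yb - pC th3 * D) - pC (kappa 0 + rho 1) * (B 1 * Yc)"
    by (subst pX_eq) (simp add: W_def D_def Yc_eq algebra_simps)
  then show ?thesis
    by (simp only: L_simps w_0 t1_s t1_s' lam_T lam_T_Yb) (simp add: algebra_simps)
qed

text \<open>The second equation multiplied by \<open>B 1\<close>. The factor t2 - 1 cancels the
  denominator of the t2-derivative, so w_0 has no pole at t2 = 1.\<close>

lemma lam_pY_W0: "lam (pY * W 0) = (t2 - 1) * s'"
proof -
  have "(1 - t2) * lam (B 1 * (E * Yb)) = lam (B 1 * (pY * Yc))"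
    using L_B_mult[OF L_eq2 t(1)] by simp
  moreover have "pY * W 0 = - (B 1 * (pY * Yc))" by (simp add: W_def mult_ac)
  ultimately show ?thesis by (simp add: L_simps mult_ac left_diff_distrib) (simp add: algebra_simps)
qed

lemma lam_pY_Q: "lam (pY * Q i) = q' i + th2 * q i"
  by (simp add: Yb_eq distrib_right L_simps mult.commute)

text \<open>The second equation multiplied by \<open>Q i\<close>, with the terms in Y
  \<open>Q i\<close> y collected on the left. Their coefficient t2 is the source of the pole at t2 =
  0.\<close>

lemma lam_pY_Q_Yb:
  assumes "i \<in> {1..n}"
  shows "t2 * lam (pY * (Q i * Yb)) = (1 - t2) * (lam (pX * (Q i * Yb)) - (kappa 0 + rho 1 + th2 + th3) * q' i)
     + th3 * (q' i + th2 * q i)"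
proof -
  have "(1 - t2) * lam (Q i * (E * Yb)) = lam (Q i * (pY * Yc))"
    using L_Q_mult[OF L_eq2 t(1)] by simp
  moreover have "Q i * (E * Yb) = pX * (Q i * Yb) + pY * (Q i * Yb) - pC (kappa 0 + rho 1 + th2 + th3) * (Q i * Yb)"
    by (simp add: E_def cpar_def cprime_def pC_simps algebra_simps)
  moreover have "Q i * (pY * Yc) = pY * (Q i * Yb) - pC th3 * (pY * Q i)"
    by (simp add: Yc_eq algebra_simps)
  ultimately show ?thesis by (simp only: L_simps lam_pY_Q) (simp add: algebra_simps)
qed

section \<open>Comparison with the rows of the residue matrices\<close>

lemma w_zero: "j > 2 * n \<Longrightarrow> w j = 0" by (simp add: w_def)

lemmas rows = row_sum_A11[OF w_zero, of n] row_sum_A01[OF w_zero, of n] row_sum_At[OF w_zero, of n]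
  row_sum_A12[OF w_zero, of n] row_sum_A02[OF w_zero, of n]

lemma index_cases:
  assumes "k \<le> 2 * n"
  obtains "k = 0" | "k \<in> {1..n}" | i where "i \<in> {1..n}" "k = n + i"
  using assms that(1,2) that(3)[of "k - n"] by (cases "k = 0"; cases "k \<le> n") auto

text \<open>With c = theta_3 the numerators are the row 0 forms of \<open>A11\<close> and
  \<open>At\<close> evaluated on \<open>w\<close>, rewritten through \<open>sum_w_le\<close> and
  \<open>sum_w_gt\<close>.\<close>

lemma weighted_div:
  "(c * w 0 + c * (\<Sum>j=1..n. e j * q j)) / (t1 - 1) = c * s"
  "(th2 * w 0 - (\<Sum>j=1..n. e j * q' j)) / (t1 - t2) = - s'"
  by (simp_all add: s_div[simplified] s'_div[simplified] minus_divide_left flip: distrib_left)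

text \<open>After division by t1, the terms t1 s and t1 s' give the poles at t1 = 1 and t1 = t2, and
  everything else is the residue at t1 = 0.\<close>

lemma pX_W_row_sums:
  assumes "k \<le> 2 * n"
  shows "lam (pX * W k) / t1 = row_sum (2 * n) (A11 n th2 th3 kappa rho) w k / (t1 - 1)
     + row_sum (2 * n) (A01 n th2 th3 kappa rho) w k / t1 + row_sum (2 * n) (At n th2 th3 kappa rho) w k / (t1 - t2)"
  using assms
proof (cases rule: index_cases)
  case 1
  have a: "row_sum (2 * n) (A11 n th2 th3 kappa rho) w k / (t1 - 1) = th3 * s"
    using n sum_w_le[of n 0] by (simp add: rows 1 weighted_div[simplified])
  have b: "row_sum (2 * n) (At n th2 th3 kappa rho) w k / (t1 - t2) = - s'"
    using n sum_w_gt[of n 0] by (simp add: rows 1 weighted_div[simplified])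
  have c: "row_sum (2 * n) (A01 n th2 th3 kappa rho) w k
      = (kappa 0 + rho 1) * w 0 - th3 * (\<Sum>j=1..n. e j * q j) + (\<Sum>j=1..n. e j * q' j)"
    using n sum_w_gt[of n 0] sum_w_le[of n 0] by (simp add: rows 1)
  show ?thesis
    unfolding a b c unfolding 1 lam_pX_W0 using t by (simp add: field_simps)
next
  case 2
  then have no: "\<not> (\<exists>i\<in>{Suc 0..n}. k = n + i)" "k \<noteq> 0" by auto
  have a: "row_sum (2 * n) (A11 n th2 th3 kappa rho) w k / (t1 - 1) = e k * (th3 * s)"
    using 2 no sum_w_le[of n 0] by (simp add: rows weighted_div[simplified] e_def[of k, symmetric] flip: times_divide_eq_right)
  have b: "row_sum (2 * n) (At n th2 th3 kappa rho) w k = 0"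
    using 2 no by (simp add: rows)
  have c: "row_sum (2 * n) (A01 n th2 th3 kappa rho) w k
      = (rho 1 - rho k) * (th3 * e k * q k) - e k * (th3 * (\<Sum>j=Suc k..n. e j * q j))"
    using 2 no w_le[of k] sum_w_le[of n k] by (simp add: rows e_def[of k, symmetric])
  have d: "lam (pX * W k) = th3 * e k * (t1 * s + (rho 1 - rho k) * q k - (\<Sum>j=Suc k..n. e j * q j))"
    using 2 no lam_pX_Q[OF 2] by (simp add: W_def L_simps mult.left_commute[of pX])
  show ?thesis
    unfolding a b c d using t by (simp add: field_simps)
next
  case (3 i)
  have a: "row_sum (2 * n) (A11 n th2 th3 kappa rho) w k = 0"
    using 3 by (simp add: rows)
  have b: "row_sum (2 * n) (At n th2 th3 kappa rho) w k / (t1 - t2) = e i * (- s')"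
    using 3 sum_w_gt[of n 0] by (simp add: rows weighted_div[simplified] e_def[of i, symmetric] flip: times_divide_eq_right)
  have c: "row_sum (2 * n) (A01 n th2 th3 kappa rho) w k
      = - ((rho 1 - rho i) * (e i * q' i)) + e i * (\<Sum>j=Suc i..n. e j * q' j)"
    using 3 w_gt[of i] sum_w_gt[of n i] by (simp add: rows e_def[of i, symmetric])
  have d: "lam (pX * W k) = - (e i * (t1 * s' + (rho 1 - rho i) * q' i - (\<Sum>j=Suc i..n. e j * q' j)))"
    using 3 lam_pX_Q_Yb[of i] by (simp add: W_def L_simps mult.left_commute[of pX])
  show ?thesis
    unfolding a b c d using t by (simp add: field_simps)
qed

text \<open>Row 0 has only the pole at t1 = t2 and rows 1 to n only the one at t2 = 1; the remaining
  rows need partial fractions in t2.\<close>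

lemma pY_W_row_sums:
  assumes "k \<le> 2 * n"
  shows "lam (pY * W k) / (t2 - 1) = - row_sum (2 * n) (At n th2 th3 kappa rho) w k / (t1 - t2)
     + row_sum (2 * n) (A12 n th2 th3 kappa rho) w k / (t2 - 1) + row_sum (2 * n) (A02 n th2 th3 kappa rho) w k / t2"
  using assms
proof (cases rule: index_cases)
  case 1
  have "row_sum (2 * n) (At n th2 th3 kappa rho) w k / (t1 - t2) = - s'"
    using n sum_w_gt[of n 0] by (simp add: rows 1 weighted_div[simplified])
  moreover have "row_sum (2 * n) (A12 n th2 th3 kappa rho) w k = 0" "row_sum (2 * n) (A02 n th2 th3 kappa rho) w k = 0"
    using n by (simp_all add: rows 1)
  ultimately show ?thesis
    using t unfolding 1 lam_pY_W0 by simp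
next
  case 2
  then have no: "\<not> (\<exists>i\<in>{Suc 0..n}. k = n + i)" "k \<noteq> 0" by auto
  have "row_sum (2 * n) (At n th2 th3 kappa rho) w k = 0" "row_sum (2 * n) (A02 n th2 th3 kappa rho) w k = 0"
    using 2 no by (simp_all add: rows)
  moreover have "row_sum (2 * n) (A12 n th2 th3 kappa rho) w k = th3 * e k * (q' k + th2 * q k)"
    using 2 no w_le[of k] w_gt[of k] by (simp add: rows) (simp add: algebra_simps)
  moreover have "lam (pY * W k) = th3 * e k * (q' k + th2 * q k)"
    using 2 no lam_pY_Q[of k] by (simp add: W_def L_simps mult.left_commute[of pY])
  ultimately show ?thesis by simp
next
  case (3 i)
  let ?u = "lam (pY * (Q i * Yb))" and ?S = "\<Sum>j=Suc 0..i-1. e j * q' j" and ?R = "q' i + th2 * q i"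
  \<comment> \<open>\<open>s'_eq\<close> trades t1 s' for t2 s', which eliminates t1 and cancels the
    tail of the sum: only j < i remains, as in \<open>A02\<close>. After division by t2 the term t2
    s' gives the pole at t1 = t2.\<close>
  let ?V = "t2 * s' + ?S - th2 * w 0 + (kappa i - kappa 0 - th2 - th3) * q' i"
  have split: "{1..n} = {Suc 0..i-1} \<union> {i..n}" using 3 by auto
  have "(\<Sum>j=1..n. e j * q' j) = ?S + (e i * q' i + (\<Sum>j=Suc i..n. e j * q' j))"
    unfolding split by (subst sum.union_disjoint) (use 3 in \<open>auto simp: sum.atLeast_Suc_atMost[of i n]\<close>)
  then have "lam (pX * (Q i * Yb)) - (kappa 0 + rho 1 + th2 + th3) * q' i = ?V"
    using lam_pX_Q_Yb[OF 3(1)] s'_eq e_def[of i] by algebra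
  then have u: "t2 * ?u = (1 - t2) * ?V + th3 * ?R"
    using lam_pY_Q_Yb[OF 3(1)] by simp
  \<comment> \<open>Partial fractions: 1 / (t2 (t2 - 1)) = 1 / (t2 - 1) - 1 / t2.\<close>
  have key: "- (c * u) / (t2 - 1) = c * V / t2 - c * th3 * R / (t2 - 1) + c * th3 * R / t2"
    if "t2 * u = (1 - t2) * V + th3 * R" for c u V R
  proof -
    have "u = ((1 - t2) * V + th3 * R) / t2" using that t by (simp add: field_simps)
    then show ?thesis using t by (simp add: divide_simps) (simp add: algebra_simps)
  qed
  have "lam (pY * W k) = - (e i * ?u)"
    using 3 by (simp add: W_def L_simps mult.left_commute[of pY])
  then have d: "lam (pY * W k) / (t2 - 1) = e i * ?V / t2 - e i * th3 * ?R / (t2 - 1) + e i * th3 * ?R / t2"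
    using key[OF u, of "e i"] by simp
  have a: "row_sum (2 * n) (At n th2 th3 kappa rho) w k / (t1 - t2) = e i * (- s')"
    using 3 sum_w_gt[of n 0] by (simp add: rows weighted_div[simplified] e_def[of i, symmetric] flip: times_divide_eq_right)
  have b: "row_sum (2 * n) (A12 n th2 th3 kappa rho) w k = - (e i * th3 * ?R)"
    using 3 w_le[of i] w_gt[of i] by (simp add: rows) (simp add: algebra_simps)
  have c: "row_sum (2 * n) (A02 n th2 th3 kappa rho) w k
      = e i * (- th2 * w 0 + th2 * th3 * q i + ?S - (th2 + kappa 0 - kappa i) * q' i)"
  proof -
    have "i - 1 \<le> n" using 3 by auto
    from sum_w_gt[OF this, of 0] show ?thesis
      using 3 w_le[of i] w_gt[of i] by (simp add: rows e_def[of i, symmetric]) (simp add: algebra_simps)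
  qed
  show ?thesis
    unfolding minus_divide_left[symmetric] a b c d using t
    by (simp add: divide_simps) (simp add: algebra_simps)
qed

end

end

theorem theorem3p3:
  fixes n :: nat and th2 th3 :: complex and kappa rho :: "nat \<Rightarrow> complex"
    and z :: "complex \<times> complex \<Rightarrow> complex" and U :: "(complex \<times> complex) set"
  assumes "n \<ge> 1"
    and "holomorphic2_on z U"
    and "\<forall>p\<in>U. eq1 n th2 th3 kappa rho z p = 0"
    and "\<forall>p\<in>U. eq2 th2 th3 kappa rho z p = 0"
  shows "\<forall>t1 t2. (t1, t2) \<in> U \<and> t1 \<noteq> 0 \<and> t1 \<noteq> 1 \<and> t2 \<noteq> 0 \<and> t2 \<noteq> 1 \<and> t1 \<noteq> t2 \<longrightarrow>
     (\<forall>k\<in>{0..2*n}.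
        (wvec n th2 th3 kappa rho z k has_derivative
          (\<lambda>h. (\<Sum>j=0..2*n. (A11 n th2 th3 kappa rho k j / (t1 - 1) + A01 n th2 th3 kappa rho k j / t1
                               + At n th2 th3 kappa rho k j / (t1 - t2))
                              * wvec n th2 th3 kappa rho z j (t1, t2)) * fst h
             + (\<Sum>j=0..2*n. (- At n th2 th3 kappa rho k j / (t1 - t2) + A12 n th2 th3 kappa rho k j / (t2 - 1)
                               + A02 n th2 th3 kappa rho k j / t2)
                              * wvec n th2 th3 kappa rho z j (t1, t2)) * snd h))
        (at (t1, t2)))"
proof (intro allI impI ballI)
  fix t1 t2 k
  assume t: "(t1, t2) \<in> U \<and> t1 \<noteq> 0 \<and> t1 \<noteq> 1 \<and> t2 \<noteq> 0 \<and> t2 \<noteq> 1 \<and> t1 \<noteq> t2" and "k \<in> {0..2*n}"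
  then have k: "k \<le> 2 * n" by simp
  interpret pfaff n th2 th3 kappa rho z U
    by standard (use assms sep_holo_if_holomorphic2 in auto)
  have t': "(t1, t2) \<in> U" "t1 \<noteq> 0" "t1 \<noteq> 1" "t2 \<noteq> 0" "t2 \<noteq> 1" "t1 \<noteq> t2" using t by auto
  let ?w = "\<lambda>j. wvec n th2 th3 kappa rho z j (t1, t2)" and ?r = "\<lambda>M. row_sum (2 * n) M (w t1 t2) k"
  have w: "?w j = w t1 t2 j" if "j \<le> 2 * n" for j
    using that wvec_eq[OF that t'(1)] by (simp add: w_def[OF t'])
  have "(\<Sum>j=0..2*n. (A11 n th2 th3 kappa rho k j / (t1 - 1) + A01 n th2 th3 kappa rho k j / t1
            + At n th2 th3 kappa rho k j / (t1 - t2)) * ?w j)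
      = ?r (A11 n th2 th3 kappa rho) / (t1 - 1) + ?r (A01 n th2 th3 kappa rho) / t1 + ?r (At n th2 th3 kappa rho) / (t1 - t2)"
    by (simp add: row_sum_def w sum_divide_distrib distrib_right sum.distrib)
  moreover have "(\<Sum>j=0..2*n. (- At n th2 th3 kappa rho k j / (t1 - t2) + A12 n th2 th3 kappa rho k j / (t2 - 1)
            + A02 n th2 th3 kappa rho k j / t2) * ?w j)
      = - ?r (At n th2 th3 kappa rho) / (t1 - t2) + ?r (A12 n th2 th3 kappa rho) / (t2 - 1) + ?r (A02 n th2 th3 kappa rho) / t2"
    by (simp add: row_sum_def w sum_divide_distrib distrib_right left_diff_distrib sum.distrib sum_subtractf sum_negf)
  \<comment> \<open>\<open>wvec\<close> agrees with the polynomial action only on \<open>U\<close>,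
    which is open, so the derivative carries over.\<close>
  moreover have "(wvec n th2 th3 kappa rho z k has_derivative
      (\<lambda>h. L (pX * W k) (t1, t2) / t1 * fst h + L (pY * W k) (t1, t2) / (t2 - 1) * snd h)) (at (t1, t2))"
    by (rule has_derivative_transform_within_open[OF act_has_derivative[OF z t'(1,2,5)] zU t'(1)])
       (simp add: wvec_eq[OF k])
  ultimately show "(wvec n th2 th3 kappa rho z k has_derivative
          (\<lambda>h. (\<Sum>j=0..2*n. (A11 n th2 th3 kappa rho k j / (t1 - 1) + A01 n th2 th3 kappa rho k j / t1
                               + At n th2 th3 kappa rho k j / (t1 - t2)) * ?w j) * fst h
             + (\<Sum>j=0..2*n. (- At n th2 th3 kappa rho k j / (t1 - t2) + A12 n th2 th3 kappa rho k j / (t2 - 1)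
                               + A02 n th2 th3 kappa rho k j / t2) * ?w j) * snd h)) (at (t1, t2))"
    by (simp only: pX_W_row_sums[OF t' k] pY_W_row_sums[OF t' k])
qed

end
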